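(* Let $e \in \mathfrak{sp}(V)$ be nilpotent, with orthogonal decomposition $$V \downarrow K[e] = \sum_{1 \leq i \leq t} W(m_i) \perp \sum_{1 \leq j \leq t'} W_{k_j}(\ell_j) \perp \sum_{1 \leq r \leq t''} V(2d_r).$$ Denote by $\alpha \geq 0$ the largest integer such that $2^{\alpha} \mid m_i,\ell_j,2d_r$ for all $i$, $j$, and $r$. Then the following hold: (i) Suppose that $V \downarrow K[e]$ is of the form $\sum_{1 \leq i \leq t} W(m_i)$. Then $$\dim \mathfrak{g}_{ad}^e = \begin{cases} \dim \mathfrak{g}_{sc}^e,& \text{ if } \alpha = 0. \\ \dim \mathfrak{g}_{sc}^e+1,& \text{ if } \alpha > 0.\end{cases}$$ (ii) Suppose that $V \downarrow K[e]$ is not of the form $\sum_{1 \leq i \leq t} W(m_i)$. Then $$\dim \mathfrak{g}_{ad}^e = \begin{cases} \dim \mathfrak{g}_{sc}^e-1,& \text{ if } \alpha = 0 .\\ \dim \mathfrak{g}_{sc}^e,& \text{ if } \alpha > 0.\end{cases}$$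
   Context: $K$ is an algebraically closed field of characteristic two. $V$ is a $K$-vector space of dimension $2\ell$ with a non-degenerate alternating bilinear form $b$; $G_{sc} = \mathrm{Sp}(V)$ (simply connected of type $C_\ell$) and $\mathfrak{g}_{sc} = \mathfrak{sp}(V)$, acting on itself by $\mathrm{ad}$. For a module $M$ on which $e$ acts, $M^e=\{x\in M: ex=0\}$. The module $\mathfrak{g}_{ad}$: this is the Lie algebra of the simple algebraic group $G_{ad}$ of adjoint type $C_\ell$; $\mathfrak{g}_{sc}$ acts on it via the differential $\mathfrak{g}_{sc}\to\mathfrak{g}_{ad}$ of the isogeny $G_{sc} \to G_{ad}$ sending root elements $x_\gamma(t)$ to $x_\gamma(t)$, followed by $\mathrm{ad}$. Explicitly: let $V_{\mathbb{C}}$ have basis $v_1,\dots,v_n$, $n=2\ell$, with alternating form $(v_i,v_{n-i+1})=1=-(v_{n-i+1},v_i)$ for $1\le i\le \ell$ and $(v_i,v_j)=0$ for $i+j\ne n+1$. Let $\mathfrak{g}_{\mathbb{Z}}$ be the $\mathbb{Z}$-span of the standard Chevalley basis of $\mathfrak{sp}(V_{\mathbb{C}})$ (with diagonal Cartan subalgebra), and $\mathfrak{g}^{ad}_{\mathbb{Z}}$ the $\mathbb{Z}$-span of $\mathfrak{g}_{\mathbb{Z}}$ and $H = \mathrm{diag}(1/2,\dots,1/2,-1/2,\dots,-1/2)$. Then $\mathfrak{g}_{sc} = K\otimes_{\mathbb{Z}}\mathfrak{g}_{\mathbb{Z}}$, $\mathfrak{g}_{ad} = K\otimes_{\mathbb{Z}}\mathfrak{g}^{ad}_{\mathbb{Z}}$,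 and $\mathfrak{g}_{sc}$ acts on $\mathfrak{g}_{ad}$ by the $K$-linear extension of the bracket $\mathfrak{g}_{\mathbb{Z}}\times\mathfrak{g}^{ad}_{\mathbb{Z}}\to\mathfrak{g}^{ad}_{\mathbb{Z}}$. $K[e]$ is the 2-Lie algebra generated by $e$ (spanned by $e, e^2, e^4,\dots$). Every nilpotent $e\in\mathfrak{sp}(V)$ admits a decomposition of $V$ as an orthogonal direct sum of $e$-invariant subspaces, each isomorphic (by an $e$-equivariant isometry) to one of the following bilinear modules; $V \downarrow K[e] = \sum W(m_i)\perp\sum W_{k_j}(\ell_j)\perp\sum V(2d_r)$ denotes such a decomposition (some of the sums possibly empty). "Of the form $\sum W(m_i)$" means that some decomposition into summands $W(m_i)$ only exists. In all definitions the space has basis $v_1,\dots,v_n$, $n=2m$, with $b(v_i,v_j)=1$ if $i+j=n+1$ and $0$ otherwise. - $V(2m)$, $m\ge1$: $ev_1=0$; $ev_i=v_{i-1}$ for $1<i\le n$. - $W(m)$, $m\ge1$: $ev_1=0$; $ev_i=v_{i-1}$ for $1<i\le m$; $ev_{m+1}=0$; $ev_i=v_{i-1}$ for $m+1<i\le n$. - $W_k(m)$, $0<k<m/2$: $ev_1=0$; $ev_{m+1}=0$; $ev_{n-k+1}=v_{n-k}+v_k$; $ev_i=v_{i-1}$ for all $i\notin\{1,m+1,n-k+1\}$. *)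

theory Defs
  imports
    Complex_Main
    "HOL-Library.Function_Algebras"
    "HOL-Library.Poly_Mapping"
    "HOL-Computational_Algebra.Polynomial"
begin

text \<open>Here \<open>V\<close> is the whole type \<open>'v\<close>, with scalar multiplication \<open>scale\<close> and form \<open>b\<close>.\<close>

definition nondeg_alternating ::
  "('k::field \<Rightarrow> 'v::ab_group_add \<Rightarrow> 'v) \<Rightarrow> ('v \<Rightarrow> 'v \<Rightarrow> 'k) \<Rightarrow> bool" where
  "nondeg_alternating scale b \<longleftrightarrow>
     (\<forall>x. Vector_Spaces.linear scale (*) (b x)) \<and>
     (\<forall>y. Vector_Spaces.linear scale (*) (\<lambda>x. b x y)) \<and>
     (\<forall>x. b x x = 0) \<and>
     (\<forall>x. (\<forall>y. b x y = 0) \<longrightarrow> x = 0)"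

definition sp ::
  "('k::field \<Rightarrow> 'v::ab_group_add \<Rightarrow> 'v) \<Rightarrow> ('v \<Rightarrow> 'v \<Rightarrow> 'k) \<Rightarrow> ('v \<Rightarrow> 'v) set" where
  "sp scale b = {x. Vector_Spaces.linear scale scale x \<and> (\<forall>u w. b (x u) w + b u (x w) = 0)}"

definition nilpotent_map :: "('v::zero \<Rightarrow> 'v) \<Rightarrow> bool" where
  "nilpotent_map e \<longleftrightarrow> (\<exists>k. \<forall>u. (e ^^ k) u = 0)"

definition sp_centralizer ::
  "('k::field \<Rightarrow> 'v::ab_group_add \<Rightarrow> 'v) \<Rightarrow> ('v \<Rightarrow> 'v \<Rightarrow> 'k) \<Rightarrow> ('v \<Rightarrow> 'v) \<Rightarrow> ('v \<Rightarrow> 'v) set" where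
  "sp_centralizer scale b e = {x \<in> sp scale b. \<forall>u. e (x u) - x (e u) = 0}"

definition dim_gsc_fixed ::
  "('k::field \<Rightarrow> 'v::ab_group_add \<Rightarrow> 'v) \<Rightarrow> ('v \<Rightarrow> 'v \<Rightarrow> 'k) \<Rightarrow> ('v \<Rightarrow> 'v) \<Rightarrow> nat" where
  "dim_gsc_fixed scale b e =
     vector_space.dim (\<lambda>c x u. scale c (x u)) (sp_centralizer scale b e)"

text \<open>\<open>v 1, \<dots>, v (2 * m)\<close> is a basis of the subspace \<open>U\<close> with antidiagonal Gram matrix.
  There are no signs because this is only used in characteristic two.\<close>

definition antidiag_basis ::
  "('k::field \<Rightarrow> 'v::ab_group_add \<Rightarrow> 'v) \<Rightarrow> ('v \<Rightarrow> 'v \<Rightarrow> 'k) \<Rightarrow> nat \<Rightarrow> (nat \<Rightarrow> 'v) \<Rightarrow> 'v set \<Rightarrow> bool" where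
  "antidiag_basis scale b m v U \<longleftrightarrow>
     inj_on v {1..2*m} \<and>
     \<not> module.dependent scale (v ` {1..2*m}) \<and>
     module.span scale (v ` {1..2*m}) = U \<and>
     (\<forall>i\<in>{1..2*m}. \<forall>j\<in>{1..2*m}. b (v i) (v j) = (if i + j = 2*m + 1 then 1 else 0))"

text \<open>\<open>Blk_W m\<close>, \<open>Blk_Wk k m\<close> and \<open>Blk_V d\<close> stand for the bilinear modules
  \<open>W(m)\<close>, \<open>W\<^sub>k(m)\<close> and \<open>V(2d)\<close>, of dimensions \<open>2m\<close>, \<open>2m\<close> and \<open>2d\<close>.\<close>

datatype block = Blk_W nat | Blk_Wk nat nat | Blk_V nat

text \<open>\<open>block_iso scale b e B U\<close>: the subspace \<open>U\<close> is \<open>e\<close>-invariant and \<open>e\<close>-equivariantly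
  isometric to the standard module \<open>B\<close>, the isometry being given by the image \<open>v\<close> of the
  standard basis.\<close>

fun block_iso ::
  "('k::field \<Rightarrow> 'v::ab_group_add \<Rightarrow> 'v) \<Rightarrow> ('v \<Rightarrow> 'v \<Rightarrow> 'k) \<Rightarrow> ('v \<Rightarrow> 'v) \<Rightarrow> block \<Rightarrow> 'v set \<Rightarrow> bool" where
  "block_iso scale b e (Blk_W m) U \<longleftrightarrow> 1 \<le> m \<and>
     (\<exists>v. antidiag_basis scale b m v U \<and>
       e (v 1) = 0 \<and> e (v (m + 1)) = 0 \<and>
       (\<forall>i\<in>{1..2*m} - {1, m + 1}. e (v i) = v (i - 1)))"
| "block_iso scale b e (Blk_Wk k m) U \<longleftrightarrow> 0 < k \<and> 2 * k < m \<and>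
     (\<exists>v. antidiag_basis scale b m v U \<and>
       e (v 1) = 0 \<and> e (v (m + 1)) = 0 \<and>
       e (v (2*m - k + 1)) = v (2*m - k) + v k \<and>
       (\<forall>i\<in>{1..2*m} - {1, m + 1, 2*m - k + 1}. e (v i) = v (i - 1)))"
| "block_iso scale b e (Blk_V d) U \<longleftrightarrow> 1 \<le> d \<and>
     (\<exists>v. antidiag_basis scale b d v U \<and>
       e (v 1) = 0 \<and>
       (\<forall>i\<in>{1..2*d} - {1}. e (v i) = v (i - 1)))"

definition orth_direct_sum :: "('v::ab_group_add \<Rightarrow> 'v \<Rightarrow> 'k::field) \<Rightarrow> 'v set list \<Rightarrow> bool" where
  "orth_direct_sum b Us \<longleftrightarrow>
     (\<forall>p<length Us. \<forall>q<length Us. p \<noteq> q \<longrightarrow> (\<forall>x\<in>Us ! p. \<forall>y\<in>Us ! q. b x y = 0)) \<and>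
     (\<forall>x. \<exists>!us. length us = length Us \<and> (\<forall>p<length Us. us ! p \<in> Us ! p) \<and> sum_list us = x)"

definition decomposes ::
  "('k::field \<Rightarrow> 'v::ab_group_add \<Rightarrow> 'v) \<Rightarrow> ('v \<Rightarrow> 'v \<Rightarrow> 'k) \<Rightarrow> ('v \<Rightarrow> 'v) \<Rightarrow> block list \<Rightarrow> bool" where
  "decomposes scale b e Bs \<longleftrightarrow>
     (\<exists>Us. list_all2 (block_iso scale b e) Bs Us \<and> orth_direct_sum b Us)"

text \<open>A complex \<open>n \<times> n\<close> matrix is a function \<open>nat \<Rightarrow> nat \<Rightarrow> complex\<close> vanishing outside
  \<open>{1..n} \<times> {1..n}\<close>.\<close>

type_synonym cmat = "nat \<Rightarrow> nat \<Rightarrow> complex"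

definition E :: "nat \<Rightarrow> nat \<Rightarrow> cmat" where
  "E i j = (\<lambda>r s. if r = i \<and> s = j then 1 else 0)"

definition bracket :: "nat \<Rightarrow> cmat \<Rightarrow> cmat \<Rightarrow> cmat" where
  "bracket n x y = (\<lambda>i j. \<Sum>k=1..n. x i k * y k j - y i k * x k j)"

text \<open>The root elements for the roots \<open>\<epsilon>\<^sub>i - \<epsilon>\<^sub>j\<close>, \<open>\<epsilon>\<^sub>i + \<epsilon>\<^sub>j\<close>, \<open>- \<epsilon>\<^sub>i - \<epsilon>\<^sub>j\<close>, \<open>2\<epsilon>\<^sub>i\<close>, \<open>-2\<epsilon>\<^sub>i\<close>,
  followed by the coroots of the simple roots \<open>\<epsilon>\<^sub>i - \<epsilon>\<^bsub>i+1\<^esub>\<close> and \<open>2\<epsilon>\<^sub>l\<close>.\<close>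

definition chevalley_basis :: "nat \<Rightarrow> cmat set" where
  "chevalley_basis l = (let n = 2 * l in
       {E i j - E (n - j + 1) (n - i + 1) | i j. i \<in> {1..l} \<and> j \<in> {1..l} \<and> i \<noteq> j}
     \<union> {E i (n - j + 1) + E j (n - i + 1) | i j. 1 \<le> i \<and> i < j \<and> j \<le> l}
     \<union> {E (n - j + 1) i + E (n - i + 1) j | i j. 1 \<le> i \<and> i < j \<and> j \<le> l}
     \<union> {E i (n - i + 1) | i. i \<in> {1..l}}
     \<union> {E (n - i + 1) i | i. i \<in> {1..l}}
     \<union> {E i i - E (i + 1) (i + 1) + E (n - i) (n - i) - E (n - i + 1) (n - i + 1) | i. 1 \<le> i \<and> i < l}
     \<union> {E l l - E (l + 1) (l + 1)})"

definition int_span :: "cmat set \<Rightarrow> cmat set" where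
  "int_span = module.span (\<lambda>(c::int) x i j. of_int c * x i j)"

definition g_int :: "nat \<Rightarrow> cmat set" where
  "g_int l = int_span (chevalley_basis l)"

definition H_ad :: "nat \<Rightarrow> cmat" where
  "H_ad l = (\<lambda>i j. if i = j \<and> i \<in> {1..l} then 1/2
                   else if i = j \<and> i \<in> {l+1..2*l} then - (1/2) else 0)"

definition g_ad_int :: "nat \<Rightarrow> cmat set" where
  "g_ad_int l = int_span (g_int l \<union> {H_ad l})"

text \<open>For an additive subgroup \<open>L\<close>, the \<open>K\<close>-space \<open>K \<otimes>\<^sub>\<int> L\<close> is the quotient of the free
  \<open>K\<close>-space \<open>tensor_free L\<close> on the set \<open>L\<close> by the subspace \<open>tensor_rel L\<close>;
  \<open>c \<otimes> x\<close> is the class of \<open>Poly_Mapping.single x c\<close>.\<close>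

definition pm_scale :: "'k::field \<Rightarrow> ('a \<Rightarrow>\<^sub>0 'k) \<Rightarrow> ('a \<Rightarrow>\<^sub>0 'k)" where
  "pm_scale c = Poly_Mapping.map (\<lambda>a. c * a)"

definition tensor_free :: "'a set \<Rightarrow> ('a \<Rightarrow>\<^sub>0 'k::field) set" where
  "tensor_free L = {u. Poly_Mapping.keys u \<subseteq> L}"

definition tensor_rel :: "'a::ab_group_add set \<Rightarrow> ('a \<Rightarrow>\<^sub>0 'k::field) set" where
  "tensor_rel L = module.span pm_scale
     {Poly_Mapping.single (x + y) 1 - Poly_Mapping.single x 1 - Poly_Mapping.single y 1 | x y.
        x \<in> L \<and> y \<in> L}"

text \<open>The dimension of \<open>U / R\<close> for subspaces \<open>R \<subseteq> U\<close>, as the size of a subset of \<open>U\<close> whose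
  elements represent distinct members of a basis of \<open>U / R\<close>.\<close>

definition quot_basis ::
  "('k::field \<Rightarrow> 'v::ab_group_add \<Rightarrow> 'v) \<Rightarrow> 'v set \<Rightarrow> 'v set \<Rightarrow> 'v set \<Rightarrow> bool" where
  "quot_basis scale S U R \<longleftrightarrow>
     S \<subseteq> U \<and> module.span scale (S \<union> R) = U \<and>
     (\<forall>F c. finite F \<and> F \<subseteq> S \<and> (\<Sum>x\<in>F. scale (c x) x) \<in> R \<longrightarrow> (\<forall>x\<in>F. c x = 0))"

definition quot_dim ::
  "('k::field \<Rightarrow> 'v::ab_group_add \<Rightarrow> 'v) \<Rightarrow> 'v set \<Rightarrow> 'v set \<Rightarrow> nat" where
  "quot_dim scale U R = card (SOME S. quot_basis scale S U R)"

text \<open>The \<open>K\<close>-bilinear extension \<open>(c \<otimes> x, d \<otimes> y) \<mapsto> cd \<otimes> [x, y]\<close> of the bracket, on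
  representatives.\<close>

definition tensor_bracket ::
  "nat \<Rightarrow> (cmat \<Rightarrow>\<^sub>0 'k::field) \<Rightarrow> (cmat \<Rightarrow>\<^sub>0 'k) \<Rightarrow> (cmat \<Rightarrow>\<^sub>0 'k)" where
  "tensor_bracket n s u =
     (\<Sum>x\<in>Poly_Mapping.keys s. \<Sum>y\<in>Poly_Mapping.keys u.
        Poly_Mapping.single (bracket n x y) (Poly_Mapping.lookup s x * Poly_Mapping.lookup u y))"

text \<open>The image in \<open>K\<close> of an integer, given as a complex number.\<close>

definition int_red :: "complex \<Rightarrow> 'k::field" where
  "int_red z = of_int (THE m. z = of_int m)"

text \<open>\<open>represents scale l v s e\<close>: under the identification of \<open>K \<otimes>\<^sub>\<int> g_int l\<close> with \<open>sp(V)\<close>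
  afforded by the basis \<open>v 1, \<dots>, v (2 * l)\<close> of \<open>V\<close>, that is, \<open>c \<otimes> x\<close> corresponds to the
  endomorphism with matrix \<open>(c * int_red (x i j))\<close>, the class of \<open>s\<close> corresponds to \<open>e\<close>.\<close>

definition represents ::
  "('k::field \<Rightarrow> 'v::ab_group_add \<Rightarrow> 'v) \<Rightarrow> nat \<Rightarrow> (nat \<Rightarrow> 'v) \<Rightarrow> (cmat \<Rightarrow>\<^sub>0 'k) \<Rightarrow> ('v \<Rightarrow> 'v) \<Rightarrow> bool" where
  "represents scale l v s e \<longleftrightarrow> s \<in> tensor_free (g_int l) \<and>
     (\<forall>j\<in>{1..2*l}. e (v j) =
        (\<Sum>i=1..2*l. scale (\<Sum>x\<in>Poly_Mapping.keys s. Poly_Mapping.lookup s x * int_red (x i j)) (v i)))"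

text \<open>The preimage in \<open>tensor_free (g_ad_int l)\<close> of the subspace of \<open>K \<otimes>\<^sub>\<int> g_ad_int l\<close>
  annihilated by \<open>e\<close>. Every \<open>e \<in> sp(V)\<close> has a representative, and the condition does not
  depend on which one is used.\<close>

definition gad_fixed ::
  "('k::field \<Rightarrow> 'v::ab_group_add \<Rightarrow> 'v) \<Rightarrow> nat \<Rightarrow> (nat \<Rightarrow> 'v) \<Rightarrow> ('v \<Rightarrow> 'v) \<Rightarrow> (cmat \<Rightarrow>\<^sub>0 'k) set" where
  "gad_fixed scale l v e =
     {u \<in> tensor_free (g_ad_int l).
        \<forall>s. represents scale l v s e \<longrightarrow> tensor_bracket (2*l) s u \<in> tensor_rel (g_ad_int l)}"

definition dim_gad_fixed ::
  "('k::field \<Rightarrow> 'v::ab_group_add \<Rightarrow> 'v) \<Rightarrow> nat \<Rightarrow> (nat \<Rightarrow> 'v) \<Rightarrow> ('v \<Rightarrow> 'v) \<Rightarrow> nat" where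
  "dim_gad_fixed scale l v e =
     quot_dim pm_scale (gad_fixed scale l v e) (tensor_rel (g_ad_int l))"

end

theory Submission
  imports Defs
begin

text \<open>
  In characteristic two \<open>g_ad\<close> is the similitude algebra \<open>gsp(V)\<close> modulo scalars: \<open>H\<close> becomes the
  projection onto a Lagrangian subspace, which has multiplier \<open>1\<close>. Hence \<open>dim g_ad^e\<close> is
  \<open>dim g_sc^e + \<delta>\<^sub>1 + \<delta>\<^sub>2 - 1\<close>, where \<open>\<delta>\<^sub>1 = 1\<close> iff some similitude with nonzero multiplier commutes
  with \<open>e\<close>, and \<open>\<delta>\<^sub>2 = 1\<close> iff some similitude \<open>x\<close> satisfies \<open>[e, x] = 1\<close>.

  If \<open>x\<close> has nonzero multiplier and commutes with \<open>e\<close>, then \<open>b(e\<^sup>j w, w) = 0\<close> for all \<open>j\<close> and \<open>w\<close>; this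
  fails on \<open>V(2d)\<close> (with \<open>j = 2d - 1\<close>) and on \<open>W\<^sub>k(m)\<close> (with \<open>j = 2k - 1\<close>), while on \<open>W(m)\<close> the
  projection onto one of the two Jordan blocks is such an \<open>x\<close>. If \<open>[e, x] = 1\<close>, then
  \<open>[e\<^sup>m, x] = m e^(m-1)\<close>, and pairing with a vector killed by \<open>e\<^sup>m\<close> forces the block size \<open>m\<close> of each \<open>W(m)\<close>
  and \<open>W\<^sub>k(m)\<close> to be even; conversely \<open>v\<^sub>i \<mapsto> i v\<^bsub>i+1\<^esub>\<close>, with a correction on \<open>W\<^sub>k(m)\<close>, gives \<open>x\<close>.
\<close>

section \<open>Dimensions of kernels and quotients\<close>

text \<open>The dimension formula is a count along three functionals on the space of all similitudes
  \<open>x\<close> with \<open>[e, x]\<close> scalar. The scalar \<open>[e, x]\<close> costs one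
  dimension if it is ever nonzero; on its kernel the multiplier costs one if it is ever nonzero
  there; what remains is \<open>g_sc^e\<close>. Dividing out the scalar matrices always costs one,
  since they commute with \<open>e\<close> and have multiplier of the form \<open>2 a = 0\<close>.
  The trace of the identity, \<open>2 l\<close>, vanishes as well, so the quotient by scalars is
  realised by requiring the entry at \<open>(1, 1)\<close> to be zero.

  The obstacle is that \<open>H\<close> has half-integral entries, so the adjoint lattice cannot be
  reduced entrywise. Subtracting the entry at \<open>(1, 1)\<close> from the diagonal repairs this
  and is compatible with brackets, scalars being central. The coordinate of \<open>H\<close>, which
  is \<open>2 x 1 1\<close>, survives in the last diagonal entry and becomes the multiplier.

  Of \<open>\<alpha>\<close> only the distinction between zero and positive enters, and
  \<open>V(2d)\<close> is a single Jordan block of even size, hence never an obstruction to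
  \<open>[e, x] = 1\<close>.\<close>

lemma (in vector_space) dim_kernel_functional:
  fixes f :: "'b \<Rightarrow> 'a"
  assumes G: "subspace G" and fin: "G \<subseteq> span W" "finite W"
    and add: "\<And>x y. x \<in> G \<Longrightarrow> y \<in> G \<Longrightarrow> f (x + y) = f x + f y"
    and scl: "\<And>c x. x \<in> G \<Longrightarrow> f (scale c x) = c * f x"
  shows "dim G = dim {x \<in> G. f x = 0} + (if \<exists>x\<in>G. f x \<noteq> 0 then 1 else 0)"
proof (cases "\<exists>x\<in>G. f x \<noteq> 0")
  case False
  then have "{x \<in> G. f x = 0} = G" by auto
  with False show ?thesis by simp
next
  case True
  then obtain a where a: "a \<in> G" "f a \<noteq> 0" by blast
  let ?A = "{x \<in> G. f x = 0}"
  have f0: "f 0 = 0" using scl[OF a(1), of 0] by simp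
  have A: "subspace ?A"
    using G f0 by (auto simp: subspace_def add scl)
  obtain B where B: "B \<subseteq> ?A" "independent B" "?A \<subseteq> span B" "card B = dim ?A"
    using basis_exists by blast
  have spB: "span B = ?A" using B A by (simp add: span_subspace)
  have finB: "finite B"
    using independent_span_bound[OF fin(2) B(2)] B(1) fin(1) by blast
  have aB: "a \<notin> span B" using spB a by simp
  have ind: "independent (insert a B)" using independent_insertI aB B(2) by blast
  have aB': "a \<notin> B" using aB span_base by blast
  have "span (insert a B) = G"
  proof (rule span_subspace)
    show "insert a B \<subseteq> G" using a B by auto
    show "G \<subseteq> span (insert a B)"
    proof
      fix x assume x: "x \<in> G"
      let ?k = "f x / f a"
      have kG: "scale (- ?k) a \<in> G" using a G by (simp add: subspace_scale del: scale_minus_left)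
      have "x + scale (- ?k) a \<in> ?A"
        using x kG subspace_add[OF G] add[OF x kG] scl[OF a(1)] a by (simp del: scale_minus_left)
      then have "x - scale ?k a \<in> span B" using spB by simp
      then show "x \<in> span (insert a B)" using span_breakdown_eq by blast
    qed
  qed (rule G)
  then have "dim G = card (insert a B)" using dim_span_eq_card_independent[OF ind] by simp
  then show ?thesis using True aB' finB B(4) by simp
qed

text \<open>\<open>quot_dim\<close> is the size of an unspecified \<open>quot_basis\<close>, so two
  things are needed: \<open>F\<close> maps every such set injectively onto a basis of the image,
  which fixes its size, and preimages of a basis of the image show that one exists.\<close>

lemma quot_dim_eq_dim_image:
  assumes lin: "Vector_Spaces.linear s1 s2 F"
    and U: "module.subspace s1 U"
    and R: "R \<subseteq> U"
    and ker: "\<And>u. u \<in> U \<Longrightarrow> F u = 0 \<longleftrightarrow> u \<in> R"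
  shows "quot_dim s1 U R = vector_space.dim s2 (F ` U)"
proof -
  interpret F: Vector_Spaces.linear s1 s2 F by (rule lin)
  have imU: "F.vs2.subspace (F ` U)" using F.subspace_image[OF U] .
  have card: "card S = F.vs2.dim (F ` U)" if S: "quot_basis s1 S U R" for S
  proof -
    have SU: "S \<subseteq> U" and sp: "F.vs1.span (S \<union> R) = U"
      and ind: "\<And>T c. finite T \<Longrightarrow> T \<subseteq> S \<Longrightarrow> (\<Sum>x\<in>T. s1 (c x) x) \<in> R \<Longrightarrow> \<forall>x\<in>T. c x = 0"
      using S by (auto simp: quot_basis_def)
    \<comment> \<open>Equal images would make \<open>x - y\<close> a relation modulo
      \<open>R\<close> with coefficients 1 and -1.\<close>
    have inj: "inj_on F S"
    proof (rule inj_onI, rule ccontr)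
      fix x y assume xy: "x \<in> S" "y \<in> S" "F x = F y" "x \<noteq> y"
      have "x - y \<in> U" using xy SU U by (meson F.vs1.subspace_diff subsetD)
      then have "x - y \<in> R" using ker[of "x - y"] xy by (simp add: F.diff)
      moreover have "(\<Sum>z\<in>{x,y}. s1 (if z = x then 1 else - 1) z) = x - y"
        using xy(4) by simp
      ultimately have "\<forall>z\<in>{x,y}. (if z = x then 1 else - 1) = (0::'a)"
        using ind[of "{x,y}" "\<lambda>z. if z = x then 1 else -1"] xy by auto
      then show False by simp
    qed
    have indep: "F.vs2.independent (F ` S)"
      unfolding F.vs2.independent_explicit_finite_subsets
    proof (intro allI impI ballI)
      fix A u z assume A: "A \<subseteq> F ` S" "finite A" and s0: "(\<Sum>v\<in>A. s2 (u v) v) = 0" and z: "z \<in> A"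
      obtain T where T: "T \<subseteq> S" "finite T" "A = F ` T"
        using finite_subset_image[OF A(2,1)] by blast
      have injT: "inj_on F T" using inj T by (meson inj_on_subset)
      have "F (\<Sum>x\<in>T. s1 (u (F x)) x) = (\<Sum>v\<in>A. s2 (u v) v)"
        unfolding T(3) by (simp add: F.sum F.scale sum.reindex[OF injT])
      moreover have "(\<Sum>x\<in>T. s1 (u (F x)) x) \<in> U"
        using U T SU by (meson F.vs1.subspace_scale F.vs1.subspace_sum subsetD)
      ultimately have "(\<Sum>x\<in>T. s1 (u (F x)) x) \<in> R" using ker s0 by simp
      from ind[OF T(2,1) this] z T(3) show "u z = 0" by auto
    qed
    have "F ` U = F.vs2.span (F ` S)"
    proof -
      have "F ` R \<subseteq> {0}" using ker R by auto
      then have "F ` (S \<union> R) \<subseteq> insert 0 (F ` S)" by auto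
      then have "F.vs2.span (F ` (S \<union> R)) \<subseteq> F.vs2.span (insert 0 (F ` S))"
        by (rule F.vs2.span_mono)
      then have "F ` U \<subseteq> F.vs2.span (F ` S)" by (simp add: F.span_image sp)
      moreover have "F.vs2.span (F ` S) \<subseteq> F ` U"
        using F.vs2.span_minimal[OF _ imU] SU by blast
      ultimately show ?thesis by blast
    qed
    then have "F.vs2.dim (F ` U) = card (F ` S)"
      using F.vs2.dim_span_eq_card_independent[OF indep] by simp
    then show ?thesis using card_image[OF inj] by simp
  qed
  obtain B where B: "B \<subseteq> F ` U" "F.vs2.independent B" "F ` U \<subseteq> F.vs2.span B"
    by (rule F.vs2.basis_exists)
  define g where "g y = (SOME x. x \<in> U \<and> F x = y)" for y
  have g: "g y \<in> U \<and> F (g y) = y" if "y \<in> B" for y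
  proof -
    have "\<exists>x. x \<in> U \<and> F x = y" using that B(1) by auto
    from someI_ex[OF this] show ?thesis by (simp add: g_def)
  qed
  have Fg: "F ` g ` B = B" using g by (force simp: image_iff)
  have injF: "inj_on F (g ` B)" using g by (auto intro!: inj_onI)
  have "quot_basis s1 (g ` B) U R"
    unfolding quot_basis_def
  proof (intro conjI allI impI)
    show gU: "g ` B \<subseteq> U" using g by auto
    show "F.vs1.span (g ` B \<union> R) = U"
    proof (rule F.vs1.span_subspace)
      show "g ` B \<union> R \<subseteq> U" using gU R by auto
      show "U \<subseteq> F.vs1.span (g ` B \<union> R)"
      proof
        fix u assume u: "u \<in> U"
        then have "F u \<in> F ` F.vs1.span (g ` B)" using B(3) F.span_image[of "g ` B"] Fg by auto
        then obtain w where w: "w \<in> F.vs1.span (g ` B)" "F u = F w" by auto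
        have wU: "w \<in> U" using w(1) F.vs1.span_minimal[OF gU U] by auto
        have "u - w \<in> R" using ker[of "u - w"] u wU w(2) F.vs1.subspace_diff[OF U] by (simp add: F.diff)
        then have "w + (u - w) \<in> F.vs1.span (g ` B \<union> R)"
          using w(1) F.vs1.span_mono[of "g ` B" "g ` B \<union> R"]
          by (intro F.vs1.span_add) (auto intro: F.vs1.span_base)
        then show "u \<in> F.vs1.span (g ` B \<union> R)" by simp
      qed
    qed (rule U)
    fix T c assume T: "finite T \<and> T \<subseteq> g ` B \<and> (\<Sum>x\<in>T. s1 (c x) x) \<in> R"
    have injT: "inj_on F T" using injF T by (meson inj_on_subset)
    have FT: "F ` T \<subseteq> B" using T Fg by blast
    have inv: "the_inv_into T F (F x) = x" if "x \<in> T" for x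
      using the_inv_into_f_f[OF injT that] .
    have "(\<Sum>y\<in>F ` T. s2 (c (the_inv_into T F y)) y) = F (\<Sum>x\<in>T. s1 (c x) x)"
      by (simp add: F.sum F.scale sum.reindex[OF injT] inv)
    also have "\<dots> = 0" using T R ker by blast
    finally have *: "(\<Sum>y\<in>F ` T. s2 (c (the_inv_into T F y)) y) = 0" .
    show "\<forall>x\<in>T. c x = 0"
    proof
      fix x assume x: "x \<in> T"
      have "c (the_inv_into T F (F x)) = 0"
        by (rule F.vs2.independentD[OF B(2) _ FT *]) (use T x in auto)
      then show "c x = 0" using inv[OF x] by simp
    qed
  qed
  then have "quot_basis s1 (SOME S. quot_basis s1 S U R) U R" by (rule someI)
  then show ?thesis unfolding quot_dim_def by (rule card)
qed

section \<open>Functionals on the free space presenting the tensor product\<close>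

text \<open>The linear extension of \<open>f\<close> from the generators; when \<open>f\<close> is
  additive on \<open>L\<close> it descends to the tensor product, see
  \<open>pm_eval_tensor_rel\<close>.\<close>

definition pm_eval :: "('a \<Rightarrow> 'k::field) \<Rightarrow> ('a \<Rightarrow>\<^sub>0 'k) \<Rightarrow> 'k" where
  "pm_eval f u = (\<Sum>x\<in>Poly_Mapping.keys u. Poly_Mapping.lookup u x * f x)"

lemma pm_eval_superset:
  assumes "finite A" "Poly_Mapping.keys u \<subseteq> A"
  shows "pm_eval f u = (\<Sum>x\<in>A. Poly_Mapping.lookup u x * f x)"
  unfolding pm_eval_def using assms
  by (intro sum.mono_neutral_left) (auto simp: in_keys_iff)

lemma pm_eval_single [simp]: "pm_eval f (Poly_Mapping.single x c) = c * f x"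
  by (simp add: pm_eval_superset[of "{x}"])

lemma pm_eval_add: "pm_eval f (u + v) = pm_eval f u + pm_eval f v"
proof -
  let ?A = "Poly_Mapping.keys u \<union> Poly_Mapping.keys v"
  have "Poly_Mapping.keys (u + v) \<subseteq> ?A" by (rule Poly_Mapping.keys_add)
  then show ?thesis
    by (simp add: pm_eval_superset[of ?A] lookup_add distrib_right sum.distrib)
qed

lemma lookup_pm_scale: "Poly_Mapping.lookup (pm_scale c u) x = c * Poly_Mapping.lookup u x"
  unfolding pm_scale_def by (simp add: Poly_Mapping.map.rep_eq when_def)

lemma vector_space_pm_scale: "vector_space pm_scale"
  by (unfold_locales; intro poly_mapping_eqI) (simp_all add: lookup_pm_scale lookup_add algebra_simps)

interpretation pm: vector_space pm_scale
  by (rule vector_space_pm_scale)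

lemma keys_pm_scale: "Poly_Mapping.keys (pm_scale c u) \<subseteq> Poly_Mapping.keys u"
  by (auto simp: in_keys_iff lookup_pm_scale)

lemma pm_eval_scale: "pm_eval f (pm_scale c u) = c * pm_eval f u"
  by (subst pm_eval_superset[OF finite_keys keys_pm_scale])
    (simp add: lookup_pm_scale pm_eval_def sum_distrib_left mult.assoc)

lemma pm_eval_zero [simp]: "pm_eval f 0 = 0"
  by (simp add: pm_eval_def)

lemma pm_eval_sum: "pm_eval f (sum g A) = (\<Sum>a\<in>A. pm_eval f (g a))"
  by (induction A rule: infinite_finite_induct) (simp_all add: pm_eval_add)

lemma pm_eval_diff: "pm_eval f (u - v) = pm_eval f u - pm_eval f v"
  using pm_eval_add[of f "u - v" v] by (simp add: algebra_simps)

lemma pm_eq_sum_single: "u = (\<Sum>x\<in>Poly_Mapping.keys u. pm_scale (Poly_Mapping.lookup u x) (Poly_Mapping.single x 1))"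
  by (intro poly_mapping_eqI)
    (simp add: lookup_sum lookup_pm_scale lookup_single when_def in_keys_iff if_distrib[of "\<lambda>t. _ * t"]
      sum.delta' cong: if_cong)

lemma pm_eval_functional_add: "pm_eval (\<lambda>x. f x + g x) u = pm_eval f u + pm_eval g u"
  by (simp add: pm_eval_def distrib_left sum.distrib)

lemma pm_eval_cong:
  "(\<And>x. x \<in> Poly_Mapping.keys u \<Longrightarrow> f x = g x) \<Longrightarrow> pm_eval f u = pm_eval g u"
  by (simp add: pm_eval_def)

lemma subspace_tensor_free: "pm.subspace (tensor_free L)"
  by (rule pm.subspaceI; unfold tensor_free_def mem_Collect_eq)
    (simp, meson Poly_Mapping.keys_add Un_least order_trans, meson keys_pm_scale order_trans)

lemma subspace_tensor_rel: "pm.subspace (tensor_rel L)"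
  by (simp add: tensor_rel_def)

lemma tensor_rel_subset_free:
  assumes add: "\<And>x y. x \<in> L \<Longrightarrow> y \<in> L \<Longrightarrow> x + y \<in> L"
  shows "tensor_rel L \<subseteq> tensor_free L"
  unfolding tensor_rel_def
proof (rule pm.span_minimal)
  have "Poly_Mapping.single x 1 \<in> tensor_free L" if "x \<in> L" for x
    using that by (simp add: tensor_free_def)
  then show "{Poly_Mapping.single (x + y) 1 - Poly_Mapping.single x 1 - Poly_Mapping.single y 1 | x y.
        x \<in> L \<and> y \<in> L} \<subseteq> tensor_free L"
    by (auto intro!: pm.subspace_diff[OF subspace_tensor_free] add)
qed (rule subspace_tensor_free)

lemma pm_eval_tensor_rel:
  assumes u: "u \<in> tensor_rel L"
    and add: "\<And>x y. x \<in> L \<Longrightarrow> y \<in> L \<Longrightarrow> f (x + y) = f x + f y"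
  shows "pm_eval f u = 0"
  using u unfolding tensor_rel_def
proof (induction rule: pm.span_induct_alt)
  case (step c x y)
  then show ?case by (auto simp: pm_eval_add pm_eval_scale pm_eval_diff add)
qed simp

text \<open>Modulo the relations, the generator of \<open>x\<close> is the sum of the generators of
  \<open>\<beta> p\<close> with coefficients \<open>\<chi> p x\<close>. Hence \<open>u\<close> is
  congruent to a combination of the generators of the \<open>\<beta> p\<close> whose coefficients
  are the linearly extended coordinates of \<open>u\<close>.\<close>

lemma tensor_rel_iff_coords:
  fixes L :: "'a::ab_group_add set" and \<chi> :: "'p \<Rightarrow> 'a \<Rightarrow> int" and m :: "int \<Rightarrow> 'a \<Rightarrow> 'a"
  assumes mod: "module m"
    and P: "finite P"
    and subL: "module.subspace m L"
    and \<beta>: "\<And>p. p \<in> P \<Longrightarrow> \<beta> p \<in> L"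
    and add: "\<And>p x y. p \<in> P \<Longrightarrow> x \<in> L \<Longrightarrow> y \<in> L \<Longrightarrow> \<chi> p (x + y) = \<chi> p x + \<chi> p y"
    and exp: "\<And>x. x \<in> L \<Longrightarrow> x = (\<Sum>p\<in>P. m (\<chi> p x) (\<beta> p))"
    and u: "(u :: 'a \<Rightarrow>\<^sub>0 'k::field) \<in> tensor_free L"
  shows "u \<in> tensor_rel L \<longleftrightarrow> (\<forall>p\<in>P. pm_eval (\<lambda>x. of_int (\<chi> p x)) u = 0)"
proof
  assume "u \<in> tensor_rel L"
  then show "\<forall>p\<in>P. pm_eval (\<lambda>x. of_int (\<chi> p x)) u = 0"
    using pm_eval_tensor_rel[of u L] add by simp
next
  interpret m: module m by (rule mod)
  let ?S = "\<lambda>x. Poly_Mapping.single x (1::'k)"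
  let ?R = "tensor_rel L :: ('a \<Rightarrow>\<^sub>0 'k) set"
  note Rs = subspace_tensor_rel[of L]
  have gen: "?S (x + y) - ?S x - ?S y \<in> ?R" if "x \<in> L" "y \<in> L" for x y
    unfolding tensor_rel_def by (rule pm.span_base) (use that in blast)
  have L0: "0 \<in> L" using m.subspace_0[OF subL] .
  \<comment> \<open>The relation for \<open>0 + 0\<close> is \<open>- ?S 0\<close>.\<close>
  have S0: "?S 0 \<in> ?R" using pm.subspace_neg[OF Rs gen[OF L0 L0]] by simp
  \<comment> \<open>The relations only mention sums; integer multiples follow by induction upwards
    and downwards from 0.\<close>
  have Sint: "?S (m c x) - pm_scale (of_int c) (?S x) \<in> ?R" if x: "x \<in> L" for c x
  proof (induction c rule: int_induct[where k = 0])
    case base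
    then show ?case using S0 by simp
  next
    case (step1 i)
    have "?S (m (i + 1) x) - pm_scale (of_int (i + 1)) (?S x) =
      (?S (m i x + x) - ?S (m i x) - ?S x) + (?S (m i x) - pm_scale (of_int i) (?S x))"
      by (simp add: m.scale_left_distrib pm.scale_left_distrib algebra_simps)
    then show ?case
      using pm.subspace_add[OF Rs gen[OF m.subspace_scale[OF subL x] x] step1(2)] by (simp only:)
  next
    case (step2 i)
    have "?S (m (i - 1) x) - pm_scale (of_int (i - 1)) (?S x) =
      (?S (m i x) - pm_scale (of_int i) (?S x)) - (?S (m (i - 1) x + x) - ?S (m (i - 1) x) - ?S x)"
      by (simp add: m.scale_left_diff_distrib pm.scale_left_diff_distrib algebra_simps)
    then show ?case
      using pm.subspace_diff[OF Rs step2(2) gen[OF m.subspace_scale[OF subL x] x]] by (simp only:)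
  qed
  have Ssum: "?S (\<Sum>p\<in>Q. m (c p) (\<beta> p)) - (\<Sum>p\<in>Q. pm_scale (of_int (c p)) (?S (\<beta> p))) \<in> ?R"
    if "Q \<subseteq> P" for Q c
    using finite_subset[OF that P] that
  proof (induction Q rule: finite_induct)
    case empty
    then show ?case using S0 by simp
  next
    case (insert q Q)
    let ?x = "m (c q) (\<beta> q)" and ?y = "\<Sum>p\<in>Q. m (c p) (\<beta> p)"
    have x: "?x \<in> L" using insert \<beta> m.subspace_scale[OF subL] by simp
    have y: "?y \<in> L" using insert \<beta> by (intro m.subspace_sum[OF subL] m.subspace_scale[OF subL]) auto
    have "?S (\<Sum>p\<in>insert q Q. m (c p) (\<beta> p)) - (\<Sum>p\<in>insert q Q. pm_scale (of_int (c p)) (?S (\<beta> p))) =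
      (?S (?x + ?y) - ?S ?x - ?S ?y) + ((?S ?x - pm_scale (of_int (c q)) (?S (\<beta> q))) +
       (?S ?y - (\<Sum>p\<in>Q. pm_scale (of_int (c p)) (?S (\<beta> p)))))"
      using insert by (simp add: algebra_simps)
    moreover have "(?S ?x - pm_scale (of_int (c q)) (?S (\<beta> q))) +
       (?S ?y - (\<Sum>p\<in>Q. pm_scale (of_int (c p)) (?S (\<beta> p)))) \<in> ?R"
      using Sint[of "\<beta> q" "c q"] insert \<beta> by (intro pm.subspace_add[OF Rs]) auto
    ultimately show ?case
      using pm.subspace_add[OF Rs gen[OF x y]] by (simp only:)
  qed
  let ?T = "\<lambda>x. \<Sum>p\<in>P. pm_scale (of_int (\<chi> p x)) (?S (\<beta> p))"
  have SR: "?S x - ?T x \<in> ?R" if "x \<in> L" for x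
    using Ssum[OF order_refl, of "\<lambda>p. \<chi> p x"] exp[OF that] by simp
  assume 0: "\<forall>p\<in>P. pm_eval (\<lambda>x. of_int (\<chi> p x)) u = 0"
  let ?K = "Poly_Mapping.keys u" and ?l = "Poly_Mapping.lookup u"
  have "(\<Sum>x\<in>?K. pm_scale (?l x) (?S x - ?T x)) \<in> ?R"
    using u SR by (intro pm.subspace_sum[OF Rs] pm.subspace_scale[OF Rs]) (auto simp: tensor_free_def)
  \<comment> \<open>Exchanging the two sums collects the coefficient belonging to each
    \<open>\<beta> p\<close>.\<close>
  moreover have "(\<Sum>x\<in>?K. pm_scale (?l x) (?T x)) =
      (\<Sum>p\<in>P. pm_scale (pm_eval (\<lambda>x. of_int (\<chi> p x)) u) (?S (\<beta> p)))"
    unfolding pm_eval_def pm.scale_sum_left pm.scale_sum_right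
    by (subst sum.swap) simp
  ultimately have "(\<Sum>x\<in>?K. pm_scale (?l x) (?S x)) \<in> ?R"
    using 0 by (simp add: pm.scale_right_diff_distrib sum_subtractf)
  then show "u \<in> ?R" using pm_eq_sum_single[of u] by simp
qed

section \<open>The lattice of adjoint type\<close>

lemma int_red_of_int [simp]: "int_red (of_int m) = of_int m"
  by (simp add: int_red_def)

lemma int_red_0 [simp]: "int_red 0 = 0"
  using int_red_of_int[of 0] by simp

lemma int_red_1 [simp]: "int_red 1 = 1"
  using int_red_of_int[of 1] by simp

lemma int_red_add: "x \<in> \<int> \<Longrightarrow> y \<in> \<int> \<Longrightarrow> int_red (x + y) = int_red x + int_red y"
  by (metis Ints_cases int_red_of_int of_int_add)

lemma int_red_mult: "x \<in> \<int> \<Longrightarrow> y \<in> \<int> \<Longrightarrow> int_red (x * y) = int_red x * int_red y"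
  by (metis Ints_cases int_red_of_int of_int_mult)

lemma int_red_minus: "x \<in> \<int> \<Longrightarrow> int_red (- x) = - int_red x"
  by (metis Ints_cases int_red_of_int of_int_minus)

lemma int_red_diff: "x \<in> \<int> \<Longrightarrow> y \<in> \<int> \<Longrightarrow> int_red (x - y) = int_red x - int_red y"
  by (metis Ints_cases int_red_of_int of_int_diff)

lemma int_red_sum: "(\<And>i. i \<in> A \<Longrightarrow> f i \<in> \<int>) \<Longrightarrow> int_red (sum f A) = (\<Sum>i\<in>A. int_red (f i))"
  by (induction A rule: infinite_finite_induct) (simp_all add: int_red_add Ints_sum)

text \<open>The scaling inside \<open>int_span\<close>, named so that the theory of modules can be
  interpreted for it.\<close>

definition int_scale :: "int \<Rightarrow> cmat \<Rightarrow> cmat" where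
  "int_scale c x = (\<lambda>i j. of_int c * x i j)"

lemma int_scale_apply: "int_scale c x i j = of_int c * x i j"
  by (simp add: int_scale_def)

interpretation im: module int_scale
  by unfold_locales (auto simp: int_scale_def algebra_simps fun_eq_iff)

lemma int_span_eq: "int_span = im.span"
proof -
  have "int_scale = (\<lambda>c x i j. of_int c * x i j)" by (simp add: int_scale_def fun_eq_iff)
  then show ?thesis by (simp add: int_span_def)
qed

section \<open>Entrywise description of the lattices\<close>

definition mirror :: "nat \<Rightarrow> nat \<Rightarrow> nat" where
  "mirror l i = 2 * l + 1 - i"

text \<open>The value of the complex form on the \<open>i\<close>-th basis vector and its partner,
  the one with index \<open>mirror l i\<close>.\<close>

definition half_sign :: "nat \<Rightarrow> nat \<Rightarrow> complex" where
  "half_sign l i = (if i \<le> l then 1 else - 1)"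

text \<open>The entries of \<open>H\<close> are half-integers; modulo scalar matrices, every element of the adjoint
  lattice becomes integral, and its reduction lands in the similitude algebra.\<close>

definition shifted :: "cmat \<Rightarrow> cmat" where
  "shifted x = (\<lambda>i j. x i j - (if i = j then x 1 1 else 0))"

text \<open>The second clause is \<open>x^T J + J x = 0\<close> in entries, where \<open>J\<close>
  has \<open>half_sign l i\<close> at \<open>(i, mirror l i)\<close> and zeros elsewhere.\<close>

definition sp_matrix :: "nat \<Rightarrow> cmat \<Rightarrow> bool" where
  "sp_matrix l x \<longleftrightarrow>
     (\<forall>i j. i \<notin> {1..2*l} \<or> j \<notin> {1..2*l} \<longrightarrow> x i j = 0) \<and>
     (\<forall>i\<in>{1..2*l}. \<forall>j\<in>{1..2*l}.
        x (mirror l j) (mirror l i) = - (half_sign l i * half_sign l j) * x i j)"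

definition sc_lattice :: "nat \<Rightarrow> cmat set" where
  "sc_lattice l = {x. sp_matrix l x \<and> (\<forall>i j. x i j \<in> \<int>)}"

definition ad_lattice :: "nat \<Rightarrow> cmat set" where
  "ad_lattice l = {x. sp_matrix l x \<and> (\<forall>i\<in>{1..2*l}. \<forall>j\<in>{1..2*l}. shifted x i j \<in> \<int>)}"

lemma mirror_in [simp]: "i \<in> {1..2*l} \<Longrightarrow> mirror l i \<in> {1..2*l}"
  by (auto simp: mirror_def)

lemma mirror_mirror [simp]: "i \<in> {1..2*l} \<Longrightarrow> mirror l (mirror l i) = i"
  by (auto simp: mirror_def)

lemma mirror_eq_iff: "i \<in> {1..2*l} \<Longrightarrow> j \<in> {1..2*l} \<Longrightarrow> mirror l i = j \<longleftrightarrow> i = mirror l j"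
  by (auto simp: mirror_def)

lemma half_sign_mirror: "i \<in> {1..2*l} \<Longrightarrow> half_sign l (mirror l i) = - half_sign l i"
  by (auto simp: mirror_def half_sign_def)

lemma half_sign_sq [simp]: "half_sign l i * half_sign l i = 1" "half_sign l i * (half_sign l i * c) = c"
  by (auto simp: half_sign_def)

lemma half_sign_Ints [simp]: "half_sign l i \<in> \<int>"
  by (auto simp: half_sign_def)

lemma shifted_add: "shifted (x + y) i j = shifted x i j + shifted y i j"
  by (simp add: shifted_def)

lemma sc_subset_ad: "sc_lattice l \<subseteq> ad_lattice l"
  by (auto simp: sc_lattice_def ad_lattice_def shifted_def)

lemma sp_matrix_0: "sp_matrix l 0"
  by (simp add: sp_matrix_def)

lemma sp_matrix_add: "sp_matrix l x \<Longrightarrow> sp_matrix l y \<Longrightarrow> sp_matrix l (x + y)"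
  by (simp add: sp_matrix_def algebra_simps)

lemma sp_matrix_int_scale: "sp_matrix l x \<Longrightarrow> sp_matrix l (int_scale c x)"
  by (auto simp: sp_matrix_def int_scale_def)

lemma subspace_sc_lattice: "im.subspace (sc_lattice l)"
  by (rule im.subspaceI)
    (auto simp: sc_lattice_def sp_matrix_0 sp_matrix_add sp_matrix_int_scale int_scale_apply)

lemma subspace_ad_lattice: "im.subspace (ad_lattice l)"
proof -
  have "shifted (int_scale c x) i j = of_int c * shifted x i j" for c x i j
    by (simp add: shifted_def int_scale_def algebra_simps)
  then show ?thesis
    by (intro im.subspaceI)
      (auto simp: ad_lattice_def sp_matrix_0 sp_matrix_add sp_matrix_int_scale shifted_add,
       simp add: shifted_def)
qed

text \<open>The root element at position \<open>(i, j)\<close>, or the coroot \<open>h\<^sub>i\<close> when \<open>i = j\<close>.\<close>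

definition root_elt :: "nat \<Rightarrow> nat \<Rightarrow> nat \<Rightarrow> cmat" where
  "root_elt l i j = (if i + j = 2 * l + 1 then E i j
     else (\<lambda>a b. E i j a b - half_sign l i * half_sign l j * E (mirror l j) (mirror l i) a b))"

lemma E_mirror:
  assumes "i \<in> {1..2*l}" "j \<in> {1..2*l}" "a \<in> {1..2*l}" "b \<in> {1..2*l}"
  shows "E i j (mirror l b) (mirror l a) = E (mirror l j) (mirror l i) a b"
  using assms mirror_eq_iff by (auto simp: E_def)

text \<open>On the antidiagonal a position is its own mirror image and the two half signs are
  opposite, so a single matrix unit satisfies the symmetry. Elsewhere the symmetry exchanges the two
  terms of \<open>root_elt\<close>.\<close>

lemma root_elt_in_sc:
  assumes i: "i \<in> {1..2*l}" and j: "j \<in> {1..2*l}"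
  shows "root_elt l i j \<in> sc_lattice l"
proof -
  note mi = mirror_in[OF i] and mj = mirror_in[OF j]
  have "sp_matrix l (root_elt l i j)"
    unfolding sp_matrix_def
  proof (intro conjI allI impI ballI)
    fix a b assume "a \<notin> {1..2*l} \<or> b \<notin> {1..2*l}"
    then have "\<not> (a = i \<and> b = j)" "\<not> (a = mirror l j \<and> b = mirror l i)"
      using i j mi mj by metis+
    then show "root_elt l i j a b = 0"
      unfolding root_elt_def E_def by (simp del: de_Morgan_conj)
  next
    fix a b assume a: "a \<in> {1..2*l}" and b: "b \<in> {1..2*l}"
    show "root_elt l i j (mirror l b) (mirror l a) = - (half_sign l a * half_sign l b) * root_elt l i j a b"
    proof (cases "i + j = 2 * l + 1")
      case True
      then have *: "mirror l j = i" "mirror l i = j" by (auto simp: mirror_def)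
      then have "half_sign l j = - half_sign l i" using half_sign_mirror[OF i] by simp
      then show ?thesis
        using True E_mirror[OF i j a b] * by (auto simp: root_elt_def E_def)
    next
      case False
      have "half_sign l (mirror l i) = - half_sign l i" "half_sign l (mirror l j) = - half_sign l j"
        using half_sign_mirror i j by auto
      then show ?thesis
        using False i j E_mirror[OF i j a b] E_mirror[OF mj mi a b]
        by (auto simp: root_elt_def E_def algebra_simps)
    qed
  qed
  moreover have "root_elt l i j a b \<in> \<int>" for a b
    by (auto simp: root_elt_def E_def)
  ultimately show ?thesis by (simp add: sc_lattice_def)
qed

lemma coroot_apply: "i \<in> {1..l} \<Longrightarrow> root_elt l i i = E i i - E (mirror l i) (mirror l i)"
  by (auto simp: root_elt_def fun_eq_iff half_sign_def)

lemma simple_coroot_eq: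
  assumes "1 \<le> i" "i < l"
  shows "E i i - E (i + 1) (i + 1) + E (2*l - i) (2*l - i) - E (2*l - i + 1) (2*l - i + 1)
    = root_elt l i i - root_elt l (i + 1) (i + 1)"
proof -
  have "mirror l i = 2*l - i + 1" "mirror l (i + 1) = 2*l - i"
    using assms by (auto simp: mirror_def)
  then show ?thesis using assms by (simp add: coroot_apply)
qed

lemma last_coroot_eq: "1 \<le> l \<Longrightarrow> E l l - E (l + 1) (l + 1) = root_elt l l l"
proof -
  assume "1 \<le> l"
  moreover have "mirror l l = l + 1" by (simp add: mirror_def)
  ultimately show ?thesis by (simp add: coroot_apply)
qed

text \<open>A position and its mirror image belong to the same root, and their index sums add up to
  \<open>4 l + 2\<close>. So the off-diagonal positions with \<open>i + j \<le> 2 l + 1\<close> meet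
  every root exactly once, which merges the five families of root elements into one.\<close>

lemma chevalley_basis_eq:
  assumes l: "1 \<le> l"
  shows "chevalley_basis l =
       {root_elt l i j | i j. i \<in> {1..2*l} \<and> j \<in> {1..2*l} \<and> i \<noteq> j \<and> i + j \<le> 2*l + 1}
     \<union> {root_elt l i i - root_elt l (i + 1) (i + 1) | i. 1 \<le> i \<and> i < l} \<union> {root_elt l l l}"
    (is "_ = ?A \<union> ?B \<union> ?C")
proof -
  let ?n = "2 * l"
  let ?A1 = "{E i j - E (?n - j + 1) (?n - i + 1) | i j. i \<in> {1..l} \<and> j \<in> {1..l} \<and> i \<noteq> j}"
  let ?A2 = "{E i (?n - j + 1) + E j (?n - i + 1) | i j. 1 \<le> i \<and> i < j \<and> j \<le> l}"
  let ?A3 = "{E (?n - j + 1) i + E (?n - i + 1) j | i j. 1 \<le> i \<and> i < j \<and> j \<le> l}"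
  let ?A4 = "{E i (?n - i + 1) | i. i \<in> {1..l}}"
  let ?A5 = "{E (?n - i + 1) i | i. i \<in> {1..l}}"
  have r1: "root_elt l i j = E i j - E (?n - j + 1) (?n - i + 1)"
    if "i \<in> {1..l}" "j \<in> {1..l}" for i j
  proof -
    have "mirror l i = ?n - i + 1" "mirror l j = ?n - j + 1" using that by (auto simp: mirror_def)
    then show ?thesis using that by (auto simp: root_elt_def half_sign_def fun_eq_iff)
  qed
  have r2: "root_elt l i (?n - j + 1) = E i (?n - j + 1) + E j (?n - i + 1)"
    if "1 \<le> i" "i < j" "j \<le> l" for i j
  proof -
    have "mirror l i = ?n - i + 1" "mirror l (?n - j + 1) = j" using that by (auto simp: mirror_def)
    then show ?thesis using that by (auto simp: root_elt_def half_sign_def fun_eq_iff)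
  qed
  have r3: "root_elt l (?n - j + 1) i = E (?n - j + 1) i + E (?n - i + 1) j"
    if "1 \<le> i" "i < j" "j \<le> l" for i j
  proof -
    have "mirror l i = ?n - i + 1" "mirror l (?n - j + 1) = j" using that by (auto simp: mirror_def)
    then show ?thesis using that by (auto simp: root_elt_def half_sign_def fun_eq_iff)
  qed
  have r4: "root_elt l i (?n - i + 1) = E i (?n - i + 1)"
    and r5: "root_elt l (?n - i + 1) i = E (?n - i + 1) i" if "i \<in> {1..l}" for i
    using that by (auto simp: root_elt_def)
  have A: "?A = ?A1 \<union> ?A2 \<union> ?A3 \<union> ?A4 \<union> ?A5"
  proof
    show "?A \<subseteq> ?A1 \<union> ?A2 \<union> ?A3 \<union> ?A4 \<union> ?A5"
    proof
      fix x assume "x \<in> ?A"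
      then obtain i j where x: "x = root_elt l i j"
        and ij: "i \<in> {1..?n}" "j \<in> {1..?n}" "i \<noteq> j" "i + j \<le> ?n + 1" by blast
      consider (1) "i \<le> l" "j \<le> l" | (2) "i \<le> l" "j > l" "i + j < ?n + 1"
        | (3) "i > l" "j \<le> l" "i + j < ?n + 1" | (4) "i \<le> l" "i + j = ?n + 1"
        | (5) "i > l" "i + j = ?n + 1"
        using ij by linarith
      then show "x \<in> ?A1 \<union> ?A2 \<union> ?A3 \<union> ?A4 \<union> ?A5"
      proof cases
        case 1
        then have "x \<in> ?A1" using x r1[of i j] ij by auto
        then show ?thesis by blast
      next
        case 2
        define j' where "j' = ?n - j + 1"
        have j: "j = ?n - j' + 1" "1 \<le> i" "i < j'" "j' \<le> l" using 2 ij by (auto simp: j'_def)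
        then have "x \<in> ?A2" using x r2[of i j'] by blast
        then show ?thesis by blast
      next
        case 3
        define i' where "i' = ?n - i + 1"
        have i: "i = ?n - i' + 1" "1 \<le> j" "j < i'" "i' \<le> l" using 3 ij by (auto simp: i'_def)
        then have "x \<in> ?A3" using x r3[of j i'] by blast
        then show ?thesis by blast
      next
        case 4
        then have "j = ?n - i + 1" by simp
        then have "x \<in> ?A4" using x r4[of i] ij 4 by auto
        then show ?thesis by blast
      next
        case 5
        then have "i = ?n - j + 1" "j \<in> {1..l}" using ij by auto
        then have "x \<in> ?A5" using x r5[of j] by auto
        then show ?thesis by blast
      qed
    qed
    have I: "root_elt l i j \<in> ?A" if "i \<in> {1..?n}" "j \<in> {1..?n}" "i \<noteq> j" "i + j \<le> ?n + 1" for i j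
      using that by blast
    have "?A1 \<subseteq> ?A"
    proof
      fix x assume "x \<in> ?A1"
      then obtain i j where ij: "x = E i j - E (?n - j + 1) (?n - i + 1)" "i \<in> {1..l}" "j \<in> {1..l}" "i \<noteq> j"
        by blast
      show "x \<in> ?A" unfolding ij(1) r1[OF ij(2,3), symmetric] by (rule I) (use ij in auto)
    qed
    moreover have "?A2 \<subseteq> ?A"
    proof
      fix x assume "x \<in> ?A2"
      then obtain i j where ij: "x = E i (?n - j + 1) + E j (?n - i + 1)" "1 \<le> i" "i < j" "j \<le> l"
        by blast
      show "x \<in> ?A" unfolding ij(1) r2[OF ij(2-4), symmetric] by (rule I) (use ij in auto)
    qed
    moreover have "?A3 \<subseteq> ?A"
    proof
      fix x assume "x \<in> ?A3"
      then obtain i j where ij: "x = E (?n - j + 1) i + E (?n - i + 1) j" "1 \<le> i" "i < j" "j \<le> l"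
        by blast
      show "x \<in> ?A" unfolding ij(1) r3[OF ij(2-4), symmetric] by (rule I) (use ij in auto)
    qed
    moreover have "?A4 \<subseteq> ?A"
    proof
      fix x assume "x \<in> ?A4"
      then obtain i where ij: "x = E i (?n - i + 1)" "i \<in> {1..l}"
        by blast
      show "x \<in> ?A" unfolding ij(1) r4[OF ij(2), symmetric] by (rule I) (use ij in auto)
    qed
    moreover have "?A5 \<subseteq> ?A"
    proof
      fix x assume "x \<in> ?A5"
      then obtain i where ij: "x = E (?n - i + 1) i" "i \<in> {1..l}"
        by blast
      show "x \<in> ?A" unfolding ij(1) r5[OF ij(2), symmetric] by (rule I) (use ij in auto)
    qed
    ultimately show "?A1 \<union> ?A2 \<union> ?A3 \<union> ?A4 \<union> ?A5 \<subseteq> ?A" by (intro Un_least)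
  qed
  have B: "?B = {E i i - E (i + 1) (i + 1) + E (?n - i) (?n - i) - E (?n - i + 1) (?n - i + 1) | i. 1 \<le> i \<and> i < l}"
    using simple_coroot_eq by (auto, metis+)
  show ?thesis
    unfolding A B last_coroot_eq[OF l, symmetric]
    by (simp only: chevalley_basis_def Let_def Un_assoc)
qed

lemma g_int_subset: "1 \<le> l \<Longrightarrow> g_int l \<subseteq> sc_lattice l"
  unfolding g_int_def int_span_eq
  by (rule im.span_minimal[OF _ subspace_sc_lattice])
    (auto simp: chevalley_basis_eq intro!: root_elt_in_sc im.subspace_diff[OF subspace_sc_lattice])

text \<open>On the diagonal the generators are the differences of consecutive coroots and the last
  coroot; descending from \<open>l\<close>, the differences telescope to each single one.\<close>

lemma root_elt_in_g_int:
  assumes l: "1 \<le> l" and ij: "i \<in> {1..2*l}" "j \<in> {1..2*l}" "i + j \<le> 2*l + 1"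
  shows "root_elt l i j \<in> g_int l"
proof (cases "i = j")
  case False
  then show ?thesis using ij unfolding g_int_def int_span_eq chevalley_basis_eq[OF l]
    by (intro im.span_base) blast
next
  case True
  then have "i \<le> l" "1 \<le> i" using ij by auto
  then have "root_elt l i i \<in> g_int l"
  proof (induction rule: inc_induct)
    case base
    then show ?case unfolding g_int_def int_span_eq chevalley_basis_eq[OF l]
      by (intro im.span_base) blast
  next
    case (step k)
    have "root_elt l k k - root_elt l (k + 1) (k + 1) \<in> g_int l"
      unfolding g_int_def int_span_eq chevalley_basis_eq[OF l]
      using step by (intro im.span_base) blast
    then have "(root_elt l k k - root_elt l (k + 1) (k + 1)) + root_elt l (k + 1) (k + 1) \<in> g_int l"
      using step unfolding g_int_def int_span_eq by (intro im.span_add) auto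
    then show ?case by simp
  qed
  then show ?thesis using True by simp
qed

lemma H_ad_in: "H_ad l \<in> ad_lattice l"
proof -
  have "H_ad l (mirror l j) (mirror l i) = - (half_sign l i * half_sign l j) * H_ad l i j"
    if "i \<in> {1..2*l}" "j \<in> {1..2*l}" for i j
  proof (cases "i = j")
    case True
    then show ?thesis using that by (auto simp: H_ad_def mirror_def half_sign_def)
  next
    case False
    then have "mirror l j \<noteq> mirror l i" using that by (auto simp: mirror_def)
    then show ?thesis using False by (simp add: H_ad_def)
  qed
  moreover have "H_ad l i j = 0" if "i \<notin> {1..2*l} \<or> j \<notin> {1..2*l}" for i j
    using that by (auto simp: H_ad_def)
  moreover have "shifted (H_ad l) i j \<in> \<int>" if "i \<in> {1..2*l}" "j \<in> {1..2*l}" for i j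
    using that by (auto simp: H_ad_def shifted_def)
  ultimately show ?thesis by (auto simp: ad_lattice_def sp_matrix_def)
qed

text \<open>One position from each mirror pair; the entries there determine a symplectic matrix, by
  \<open>sp_matrix_eqI\<close>.\<close>

definition upper :: "nat \<Rightarrow> (nat \<times> nat) set" where
  "upper l = {(i, j). i \<in> {1..2*l} \<and> j \<in> {1..2*l} \<and> i + j \<le> 2*l + 1}"

definition ad_basis :: "nat \<Rightarrow> nat \<times> nat \<Rightarrow> cmat" where
  "ad_basis l p = (if p = (1, 1) then H_ad l else root_elt l (fst p) (snd p))"

text \<open>The position \<open>(1, 1)\<close> stands for \<open>H\<close>, which replaces the coroot \<open>h\<^sub>1 = 2H - h\<^sub>2 - \<dots> - h\<^sub>l\<close>.\<close>

definition ad_coord :: "nat \<times> nat \<Rightarrow> cmat \<Rightarrow> complex" where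
  "ad_coord p x = (if p = (1, 1) then 2 * x 1 1 else shifted x (fst p) (snd p))"

definition ad_coord_int :: "nat \<times> nat \<Rightarrow> cmat \<Rightarrow> int" where
  "ad_coord_int p x = \<lfloor>Re (ad_coord p x)\<rfloor>"

lemma finite_upper: "finite (upper l)"
  by (rule finite_subset[of _ "{1..2*l} \<times> {1..2*l}"]) (auto simp: upper_def)

lemma last_diag:
  assumes "1 \<le> l" "sp_matrix l x"
  shows "x (2*l) (2*l) = - x 1 1"
proof -
  have "mirror l 1 = 2*l" by (simp add: mirror_def)
  moreover have "1 \<in> {1..2*l}" using assms by simp
  ultimately show ?thesis using assms unfolding sp_matrix_def by (metis half_sign_sq(1) mult_minus1)
qed

text \<open>Opposite corners of the diagonal are negatives of each other, so the shift doubles up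
  here. This is what makes \<open>2 * x 1 1\<close> integral on \<open>ad_lattice\<close>, and the
  reduction of this entry will be the multiplier.\<close>

lemma shifted_last:
  assumes "1 \<le> l" "sp_matrix l x"
  shows "shifted x (2*l) (2*l) = - 2 * x 1 1"
  using last_diag[OF assms] by (simp add: shifted_def)

lemma ad_coord_Ints:
  assumes l: "1 \<le> l" and x: "x \<in> ad_lattice l" and p: "p \<in> upper l"
  shows "ad_coord p x \<in> \<int>"
proof (cases "p = (1, 1)")
  case True
  have "shifted x (2*l) (2*l) \<in> \<int>" using x l by (simp add: ad_lattice_def)
  then have "- (2 * x 1 1) \<in> \<int>" using shifted_last[OF l] x by (simp add: ad_lattice_def)
  then show ?thesis using True by (simp add: ad_coord_def)
next
  case False
  then show ?thesis using p x by (auto simp: ad_coord_def ad_lattice_def upper_def)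
qed

lemma of_int_ad_coord_int:
  assumes "1 \<le> l" "x \<in> ad_lattice l" "p \<in> upper l"
  shows "of_int (ad_coord_int p x) = ad_coord p x"
  using ad_coord_Ints[OF assms] by (auto simp: ad_coord_int_def elim: Ints_cases)

lemma ad_coord_add: "ad_coord p (x + y) = ad_coord p x + ad_coord p y"
  by (simp add: ad_coord_def shifted_add distrib_left)

lemma ad_coord_scale: "ad_coord p (int_scale c x) = of_int c * ad_coord p x"
  by (simp add: ad_coord_def shifted_def int_scale_apply algebra_simps)

lemma ad_coord_sum: "ad_coord p (sum f A) = (\<Sum>q\<in>A. ad_coord p (f q))"
proof (induction A rule: infinite_finite_induct)
  case (insert q A)
  then show ?case by (simp only: sum.insert ad_coord_add not_False_eq_True)
qed (auto simp: ad_coord_def shifted_def)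

text \<open>The mirrored term of a root element with index in \<open>upper l\<close> lies strictly
  below the antidiagonal or is absent, so only the leading matrix unit is visible.\<close>

lemma root_elt_upper:
  assumes p: "(i, j) \<in> upper l" and q: "(a, b) \<in> upper l"
  shows "root_elt l a b i j = (if (a, b) = (i, j) then 1 else 0)"
proof (cases "a + b = 2 * l + 1")
  case True
  then show ?thesis by (auto simp: root_elt_def E_def)
next
  case False
  then have "mirror l b + mirror l a > 2 * l + 1" using q by (auto simp: upper_def mirror_def)
  then have "E (mirror l b) (mirror l a) i j = 0" using p by (auto simp: E_def upper_def)
  then show ?thesis using False by (auto simp: root_elt_def E_def)
qed

lemma ad_coord_ad_basis:
  assumes l: "1 \<le> l" and p: "p \<in> upper l" and q: "q \<in> upper l"
  shows "ad_coord p (ad_basis l q) = (if p = q then 1 else 0)"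
proof -
  obtain i j a b where pq: "p = (i, j)" "q = (a, b)" by fastforce
  have 11: "(1, 1) \<in> upper l" using l by (auto simp: upper_def)
  show ?thesis
  proof (cases "q = (1, 1)")
    case True
    \<comment> \<open>On the diagonal, \<open>upper l\<close> contains only positions with
      \<open>i \<le> l\<close>. There all entries of \<open>H\<close> equal 1/2, so the shift erases
      them.\<close>
    have "i \<le> l" if "i = j" using p that by (auto simp: pq upper_def)
    then show ?thesis using True pq l p
      by (auto simp: ad_coord_def ad_basis_def shifted_def H_ad_def upper_def)
  next
    case False
    have "root_elt l a b 1 1 = 0" using root_elt_upper[OF 11] q False pq by auto
    then show ?thesis using False root_elt_upper[of i j l a b] p q pq
      by (auto simp: ad_coord_def ad_basis_def shifted_def)
  qed
qed

lemma sp_matrix_eqI: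
  assumes x: "sp_matrix l x" and y: "sp_matrix l y"
    and up: "\<And>i j. (i, j) \<in> upper l \<Longrightarrow> x i j = y i j"
  shows "x = y"
proof (intro ext)
  fix i j
  show "x i j = y i j"
  proof (cases "i \<in> {1..2*l} \<and> j \<in> {1..2*l}")
    case False
    then show ?thesis using x y unfolding sp_matrix_def by metis
  next
    case True
    then have i: "i \<in> {1..2*l}" and j: "j \<in> {1..2*l}" by auto
    show ?thesis
    proof (cases "(i, j) \<in> upper l")
      case False
      then have "(mirror l j, mirror l i) \<in> upper l"
        using i j by (auto simp: upper_def mirror_def)
      then have *: "x (mirror l j) (mirror l i) = y (mirror l j) (mirror l i)" by (rule up)
      have r: "z i j = - (half_sign l (mirror l j) * half_sign l (mirror l i)) * z (mirror l j) (mirror l i)"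
        if z: "sp_matrix l z" for z
        using z mirror_in[OF i] mirror_in[OF j] mirror_mirror[OF i] mirror_mirror[OF j]
        unfolding sp_matrix_def by metis
      show ?thesis using r[OF x] r[OF y] * by simp
    qed (rule up)
  qed
qed

lemma ad_basis_in_ad: "p \<in> upper l \<Longrightarrow> ad_basis l p \<in> ad_lattice l"
  using subsetD[OF sc_subset_ad root_elt_in_sc]
  by (cases p) (simp add: ad_basis_def H_ad_in upper_def)

lemma ad_lattice_expand:
  assumes l: "1 \<le> l" and x: "x \<in> ad_lattice l"
  shows "x = (\<Sum>p\<in>upper l. int_scale (ad_coord_int p x) (ad_basis l p))" (is "x = ?y")
proof -
  have y: "?y \<in> ad_lattice l"
    using ad_basis_in_ad by (intro im.subspace_sum im.subspace_scale subspace_ad_lattice)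
  have c: "ad_coord p x = ad_coord p ?y" if p: "p \<in> upper l" for p
    using finite_upper p
    by (simp add: ad_coord_sum ad_coord_scale ad_coord_ad_basis[OF l] of_int_ad_coord_int[OF l x]
        if_distrib[of "\<lambda>t. _ * t"] sum.delta' cong: if_cong)
  \<comment> \<open>The other diagonal coordinates are relative to \<open>x 1 1\<close>, so this
    entry has to be recovered first.\<close>
  have "(1, 1) \<in> upper l" using l by (auto simp: upper_def)
  from c[OF this] have 11: "x 1 1 = ?y 1 1" by (simp add: ad_coord_def)
  have "x i j = ?y i j" if "(i, j) \<in> upper l" for i j
    using c[OF that] 11 by (auto simp: ad_coord_def shifted_def split: if_splits)
  then show ?thesis
    using x y by (intro sp_matrix_eqI[of l]) (auto simp: ad_lattice_def)
qed

text \<open>Replaces the span by entrywise conditions, so that membership of a bracket can be tested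
  on entries and integral coordinates become available.\<close>

lemma g_ad_int_eq:
  assumes l: "1 \<le> l"
  shows "g_ad_int l = ad_lattice l"
proof
  show "g_ad_int l \<subseteq> ad_lattice l"
    unfolding g_ad_int_def int_span_eq
    using g_int_subset[OF l] sc_subset_ad H_ad_in by (intro im.span_minimal subspace_ad_lattice) auto
  have "ad_basis l p \<in> g_ad_int l" if "p \<in> upper l" for p
    using that root_elt_in_g_int[OF l] unfolding g_ad_int_def int_span_eq
    by (intro im.span_base) (auto simp: ad_basis_def upper_def)
  then have "(\<Sum>p\<in>upper l. int_scale (ad_coord_int p x) (ad_basis l p)) \<in> g_ad_int l" for x
    unfolding g_ad_int_def int_span_eq by (intro im.span_sum im.span_scale) auto
  then show "ad_lattice l \<subseteq> g_ad_int l" using ad_lattice_expand[OF l] by (metis subsetI)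
qed

section \<open>Reduction of tensors to matrices over \<open>K\<close>\<close>

text \<open>The shift has to precede the reduction, because a half-integral entry has no image in
  characteristic two.\<close>

definition ad_red :: "(cmat \<Rightarrow>\<^sub>0 'k::field) \<Rightarrow> nat \<Rightarrow> nat \<Rightarrow> 'k" where
  "ad_red u i j = pm_eval (\<lambda>y. int_red (shifted y i j)) u"

definition sc_red :: "(cmat \<Rightarrow>\<^sub>0 'k::field) \<Rightarrow> nat \<Rightarrow> nat \<Rightarrow> 'k" where
  "sc_red s i j = pm_eval (\<lambda>x. int_red (x i j)) s"

lemma ad_red_add: "ad_red (u + w) i j = ad_red u i j + ad_red w i j"
  by (simp add: ad_red_def pm_eval_add)

lemma ad_red_scale: "ad_red (pm_scale c u) i j = c * ad_red u i j"
  by (simp add: ad_red_def pm_eval_scale)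

lemma ad_red_1_1 [simp]: "ad_red u 1 1 = 0" "ad_red u (Suc 0) (Suc 0) = 0"
  by (simp_all add: ad_red_def shifted_def pm_eval_def)

text \<open>\<open>y\<close> and \<open>shifted y\<close> differ by a scalar matrix on these
  indices, and scalar matrices are central.\<close>

lemma bracket_eq_shifted:
  assumes "i \<in> {1..n}" "j \<in> {1..n}"
  shows "bracket n x y i j = (\<Sum>k=1..n. x i k * shifted y k j - shifted y i k * x k j)"
proof -
  have 1: "(\<Sum>k=1..n. x i k * (if k = j then y 1 1 else 0)) = x i j * y 1 1"
    using assms by (simp add: if_distrib[of "\<lambda>t. _ * t"] sum.delta cong: if_cong)
  have 2: "(\<Sum>k=1..n. (if i = k then y 1 1 else 0) * x k j) = y 1 1 * x i j"
    using assms by (simp add: if_distrib[of "\<lambda>t. t * _"] sum.delta' cong: if_cong)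
  have "(\<Sum>k=1..n. x i k * shifted y k j - shifted y i k * x k j) =
    bracket n x y i j - ((\<Sum>k=1..n. x i k * (if k = j then y 1 1 else 0))
      - (\<Sum>k=1..n. (if i = k then y 1 1 else 0) * x k j))"
    unfolding bracket_def shifted_def sum_subtractf[symmetric]
    by (intro sum.cong refl) (simp add: algebra_simps)
  also have "\<dots> = bracket n x y i j" unfolding 1 2 by simp
  finally show ?thesis by simp
qed

lemma bracket_sp_matrix:
  assumes x: "sp_matrix l x" and y: "sp_matrix l y"
  shows "sp_matrix l (bracket (2*l) x y)"
  unfolding sp_matrix_def
proof (intro conjI allI impI ballI)
  fix i j assume "i \<notin> {1..2*l} \<or> j \<notin> {1..2*l}"
  then have "(\<forall>k. x i k = 0 \<and> y i k = 0) \<or> (\<forall>k. x k j = 0 \<and> y k j = 0)"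
    using x y unfolding sp_matrix_def by blast
  then show "bracket (2*l) x y i j = 0"
    unfolding bracket_def by (intro sum.neutral) auto
next
  fix i j assume i: "i \<in> {1..2*l}" and j: "j \<in> {1..2*l}"
  let ?c = "half_sign l i * half_sign l j"
  have X: "x (mirror l b) (mirror l a) = - (half_sign l a * half_sign l b) * x a b"
    and Y: "y (mirror l b) (mirror l a) = - (half_sign l a * half_sign l b) * y a b"
    if "a \<in> {1..2*l}" "b \<in> {1..2*l}" for a b
    using x y that unfolding sp_matrix_def by blast+
  \<comment> \<open>Summing over \<open>mirror l k\<close> instead of \<open>k\<close>, the symmetry
    applies to every factor. The sign of \<open>k\<close> occurs twice and cancels, and since the
    factors swap order, the commutator changes sign.\<close>
  have "bij_betw (mirror l) {1..2*l} {1..2*l}"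
    by (rule bij_betw_byWitness[where f' = "mirror l"]) (auto simp: mirror_def)
  then have "bracket (2*l) x y (mirror l j) (mirror l i) =
    (\<Sum>k=1..2*l. x (mirror l j) (mirror l k) * y (mirror l k) (mirror l i)
       - y (mirror l j) (mirror l k) * x (mirror l k) (mirror l i))"
    unfolding bracket_def by (rule sum.reindex_bij_betw[symmetric])
  also have "\<dots> = (\<Sum>k=1..2*l. - ?c * (x i k * y k j - y i k * x k j))"
  proof (intro sum.cong refl)
    fix k assume k: "k \<in> {1..2*l}"
    have [simp]: "half_sign l k * (a * (half_sign l k * b)) = a * b" for a b
      by (metis half_sign_sq(2) mult.left_commute)
    show "x (mirror l j) (mirror l k) * y (mirror l k) (mirror l i)
       - y (mirror l j) (mirror l k) * x (mirror l k) (mirror l i) = - ?c * (x i k * y k j - y i k * x k j)"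
      unfolding X[OF i k] X[OF k j] Y[OF i k] Y[OF k j] by (simp add: algebra_simps)
  qed
  finally show "bracket (2*l) x y (mirror l j) (mirror l i) = - ?c * bracket (2*l) x y i j"
    unfolding bracket_def by (simp add: sum_distrib_left)
qed

text \<open>Only the integral matrix \<open>shifted y\<close> enters the bracket, so the result is
  integral even when \<open>y\<close> is not.\<close>

lemma bracket_in_sc:
  assumes x: "x \<in> sc_lattice l" and y: "y \<in> ad_lattice l"
  shows "bracket (2*l) x y \<in> sc_lattice l"
proof -
  have sp: "sp_matrix l (bracket (2*l) x y)"
    using x y bracket_sp_matrix by (auto simp: sc_lattice_def ad_lattice_def)
  have "bracket (2*l) x y i j \<in> \<int>" for i j
  proof (cases "i \<in> {1..2*l} \<and> j \<in> {1..2*l}")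
    case True
    then show ?thesis using x y unfolding bracket_eq_shifted[OF conjunct1[OF True] conjunct2[OF True]]
      by (intro Ints_sum Ints_diff Ints_mult) (auto simp: sc_lattice_def ad_lattice_def)
  next
    case False
    then have "bracket (2*l) x y i j = 0" using sp unfolding sp_matrix_def by blast
    then show ?thesis by simp
  qed
  then show ?thesis using sp by (simp add: sc_lattice_def)
qed

text \<open>\<open>C\<close> is the commutator of the reduced matrices. The bracket is itself
  shifted before it is reduced, which subtracts \<open>C 1 1\<close> on the diagonal: the action is
  the commutator modulo scalars.\<close>

lemma ad_red_bracket:
  fixes s u :: "cmat \<Rightarrow>\<^sub>0 'k::field"
  assumes l: "1 \<le> l" and s: "s \<in> tensor_free (g_int l)" and u: "u \<in> tensor_free (g_ad_int l)"
    and i: "i \<in> {1..2*l}" and j: "j \<in> {1..2*l}"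
  defines "C \<equiv> \<lambda>i j. \<Sum>k=1..2*l. sc_red s i k * ad_red u k j - ad_red u i k * sc_red s k j"
  shows "ad_red (tensor_bracket (2*l) s u) i j = C i j - (if i = j then C 1 1 else 0)"
proof -
  let ?ks = "Poly_Mapping.keys s" and ?ku = "Poly_Mapping.keys u"
  let ?ls = "Poly_Mapping.lookup s" and ?lu = "Poly_Mapping.lookup u"
  have ks: "x \<in> sc_lattice l" if "x \<in> ?ks" for x
    using that s g_int_subset[OF l] by (auto simp: tensor_free_def)
  have ku: "y \<in> ad_lattice l" if "y \<in> ?ku" for y
    using that u g_ad_int_eq[OF l] by (auto simp: tensor_free_def)
  define g :: "nat \<Rightarrow> nat \<Rightarrow> cmat \<Rightarrow> cmat \<Rightarrow> 'k" where "g i j x y = (\<Sum>k=1..2*l. int_red (x i k) * int_red (shifted y k j)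
      - int_red (shifted y i k) * int_red (x k j))" for i j x y
  have red: "int_red (bracket (2*l) x y i j) = g i j x y"
    if "x \<in> ?ks" "y \<in> ?ku" "i \<in> {1..2*l}" "j \<in> {1..2*l}" for x y i j
    using ks[OF that(1)] ku[OF that(2)] that(3,4) unfolding g_def bracket_eq_shifted[OF that(3,4)]
    by (subst int_red_sum)
      (auto simp: sc_lattice_def ad_lattice_def int_red_diff int_red_mult intro!: Ints_diff Ints_mult)
  have 11: "1 \<in> {1..2*l}" using l by simp
  have sh: "int_red (shifted (bracket (2*l) x y) i j) = g i j x y - (if i = j then g 1 1 x y else 0)"
    if xy: "x \<in> ?ks" "y \<in> ?ku" for x y
  proof -
    have "\<And>a b. bracket (2*l) x y a b \<in> \<int>"
      using bracket_in_sc[OF ks[OF xy(1)] ku[OF xy(2)]] by (simp add: sc_lattice_def)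
    then show ?thesis using red[OF xy i j] red[OF xy 11 11] by (simp add: shifted_def int_red_diff)
  qed
  have C: "(\<Sum>x\<in>?ks. \<Sum>y\<in>?ku. ?ls x * ?lu y * g i j x y) = C i j" for i j
  proof -
    have "(\<Sum>x\<in>?ks. \<Sum>y\<in>?ku. ?ls x * ?lu y * g i j x y) =
      (\<Sum>k=1..2*l. \<Sum>x\<in>?ks. \<Sum>y\<in>?ku. ?ls x * ?lu y * (int_red (x i k) * int_red (shifted y k j)
      - int_red (shifted y i k) * int_red (x k j)))"
      unfolding g_def sum_distrib_left
      by (subst sum.swap[of _ ?ks "{1..2*l}"], rule sum.cong[OF refl], rule sum.swap)
    also have "\<dots> = C i j"
      unfolding C_def sc_red_def ad_red_def pm_eval_def
      by (intro sum.cong refl)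
        (simp add: sum_product sum_subtractf[symmetric] sum.swap[of _ ?ks ?ku] algebra_simps)
    finally show ?thesis .
  qed
  have "ad_red (tensor_bracket (2*l) s u) i j =
    (\<Sum>x\<in>?ks. \<Sum>y\<in>?ku. ?ls x * ?lu y * (g i j x y - (if i = j then g 1 1 x y else 0)))"
    unfolding ad_red_def tensor_bracket_def pm_eval_sum by (simp add: sh)
  also have "\<dots> = C i j - (if i = j then C 1 1 else 0)"
    using C by (simp add: right_diff_distrib sum_subtractf)
  finally show ?thesis .
qed

lemma tensor_bracket_free:
  assumes l: "1 \<le> l" and s: "s \<in> tensor_free (g_int l)" and u: "u \<in> tensor_free (g_ad_int l)"
  shows "tensor_bracket (2*l) s u \<in> tensor_free (g_ad_int l)"
  unfolding tensor_bracket_def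
proof (intro pm.subspace_sum[OF subspace_tensor_free])
  fix x y assume xy: "x \<in> Poly_Mapping.keys s" "y \<in> Poly_Mapping.keys u"
  then have "x \<in> sc_lattice l" "y \<in> ad_lattice l"
    using s u g_int_subset[OF l] g_ad_int_eq[OF l] by (auto simp: tensor_free_def)
  then have "bracket (2*l) x y \<in> g_ad_int l"
    using bracket_in_sc sc_subset_ad g_ad_int_eq[OF l] by blast
  then show "Poly_Mapping.single (bracket (2*l) x y) (Poly_Mapping.lookup s x * Poly_Mapping.lookup u y)
      \<in> tensor_free (g_ad_int l)"
    by (simp add: tensor_free_def)
qed

lemma char_two_add_self: "CHAR('k::field) = 2 \<Longrightarrow> x + x = (0::'k)"
  by (metis mult_2 mult_zero_left of_nat_CHAR of_nat_numeral)

lemma char_two_minus: "CHAR('k::field) = 2 \<Longrightarrow> - x = (x::'k)"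
  using char_two_add_self minus_unique by blast

lemma char_two_diff: "CHAR('k::field) = 2 \<Longrightarrow> x - y = (y + x :: 'k)"
  by (metis char_two_minus diff_minus_eq_add minus_diff_eq add.commute)

lemma int_red_half_sign:
  "CHAR('k::field) = 2 \<Longrightarrow> x \<in> \<int> \<Longrightarrow> int_red (- (half_sign l i * half_sign l j) * x) = (int_red x :: 'k)"
  by (auto simp: half_sign_def int_red_minus char_two_minus)

text \<open>Signs disappear in characteristic two, leaving symmetry under the mirror off the
  diagonal. On the diagonal negation and shift do not commute; the discrepancy
  \<open>- 2 * y 1 1\<close> is the last shifted entry.\<close>

lemma ad_red_mirror:
  fixes u :: "cmat \<Rightarrow>\<^sub>0 'k::field"
  assumes l: "1 \<le> l" and c2: "CHAR('k) = 2" and u: "u \<in> tensor_free (g_ad_int l)"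
    and i: "i \<in> {1..2*l}" and j: "j \<in> {1..2*l}"
  shows "ad_red u (mirror l j) (mirror l i) = ad_red u i j + (if i = j then ad_red u (2*l) (2*l) else 0)"
proof -
  have "int_red (shifted y (mirror l j) (mirror l i)) =
      (int_red (shifted y i j) + (if i = j then int_red (shifted y (2*l) (2*l)) else 0) :: 'k)"
    if "y \<in> Poly_Mapping.keys u" for y
  proof -
    have y: "sp_matrix l y" and Y: "\<And>i j. i \<in> {1..2*l} \<Longrightarrow> j \<in> {1..2*l} \<Longrightarrow> shifted y i j \<in> \<int>"
      using that u g_ad_int_eq[OF l] by (auto simp: tensor_free_def ad_lattice_def)
    have m: "y (mirror l j) (mirror l i) = - (half_sign l i * half_sign l j) * y i j"
      using y i j unfolding sp_matrix_def by blast
    show ?thesis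
    proof (cases "i = j")
      case True
      have "shifted y (mirror l j) (mirror l i) = - shifted y i j + shifted y (2*l) (2*l)"
        using m True last_diag[OF l y] by (simp add: shifted_def)
      then show ?thesis
        using True Y[OF i j] Y[of "2*l" "2*l"] l c2
        by (simp add: int_red_diff char_two_diff)
    next
      case False
      then have "mirror l j \<noteq> mirror l i" using i j by (metis mirror_mirror)
      then have "shifted y (mirror l j) (mirror l i) = - (half_sign l i * half_sign l j) * shifted y i j"
        using m False by (simp add: shifted_def)
      then show ?thesis using False int_red_half_sign[OF c2 Y[OF i j]] by simp
    qed
  qed
  then have "ad_red u (mirror l j) (mirror l i) =
    pm_eval (\<lambda>y. int_red (shifted y i j) + (if i = j then int_red (shifted y (2*l) (2*l)) else 0)) u"
    unfolding ad_red_def by (rule pm_eval_cong)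
  then show ?thesis by (simp add: pm_eval_functional_add ad_red_def) (simp add: pm_eval_def)
qed

lemma sc_red_mirror:
  fixes s :: "cmat \<Rightarrow>\<^sub>0 'k::field"
  assumes l: "1 \<le> l" and c2: "CHAR('k) = 2" and s: "s \<in> tensor_free (g_int l)"
    and i: "i \<in> {1..2*l}" and j: "j \<in> {1..2*l}"
  shows "sc_red s (mirror l j) (mirror l i) = sc_red s i j"
  unfolding sc_red_def
proof (rule pm_eval_cong)
  fix x assume "x \<in> Poly_Mapping.keys s"
  then have x: "x \<in> sc_lattice l" using s g_int_subset[OF l] by (auto simp: tensor_free_def)
  then have "x (mirror l j) (mirror l i) = - (half_sign l i * half_sign l j) * x i j"
    using i j unfolding sc_lattice_def sp_matrix_def by blast
  then show "(int_red (x (mirror l j) (mirror l i)) :: 'k) = int_red (x i j)"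
    using int_red_half_sign[OF c2] x by (simp add: sc_lattice_def)
qed

lemma upper_or_mirror:
  assumes "i \<in> {1..2*l}" "j \<in> {1..2*l}"
  shows "(i, j) \<in> upper l \<or> (mirror l j, mirror l i) \<in> upper l"
  using assms by (auto simp: upper_def mirror_def)

text \<open>The coordinate \<open>2 * x 1 1\<close> of \<open>H\<close> is invisible at
  \<open>(1, 1)\<close> after the shift, but reappears negated in the last corner.\<close>

lemma pm_eval_ad_coord:
  fixes u :: "cmat \<Rightarrow>\<^sub>0 'k::field"
  assumes l: "1 \<le> l" and u: "u \<in> tensor_free (g_ad_int l)" and p: "p \<in> upper l"
  shows "pm_eval (\<lambda>x. of_int (ad_coord_int p x)) u =
    (if p = (1, 1) then - ad_red u (2*l) (2*l) else ad_red u (fst p) (snd p))"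
proof -
  have *: "of_int (ad_coord_int p y) =
      (if p = (1, 1) then - 1 * int_red (shifted y (2*l) (2*l)) else int_red (shifted y (fst p) (snd p)) :: 'k)"
    if "y \<in> Poly_Mapping.keys u" for y
  proof -
    have y: "y \<in> ad_lattice l" using that u g_ad_int_eq[OF l] by (auto simp: tensor_free_def)
    have "(of_int (ad_coord_int p y) :: 'k) = int_red (of_int (ad_coord_int p y))"
      by simp
    also have "\<dots> = int_red (ad_coord p y)"
      using of_int_ad_coord_int[OF l y p] by simp
    also have "\<dots> = (if p = (1, 1) then int_red (- shifted y (2*l) (2*l)) else int_red (shifted y (fst p) (snd p)))"
      using shifted_last[OF l, of y] y by (simp add: ad_coord_def ad_lattice_def)
    also have "\<dots> = (if p = (1, 1) then - 1 * int_red (shifted y (2*l) (2*l)) else int_red (shifted y (fst p) (snd p)))"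
      using y l by (simp add: int_red_minus ad_lattice_def)
    finally show ?thesis .
  qed
  have "pm_eval (\<lambda>x. of_int (ad_coord_int p x)) u = pm_eval (\<lambda>y. if p = (1, 1)
      then - 1 * int_red (shifted y (2*l) (2*l)) else int_red (shifted y (fst p) (snd p))) u"
    by (rule pm_eval_cong) (rule *)
  then show ?thesis
    by (auto simp: ad_red_def pm_eval_def sum_negf)
qed

text \<open>Injectivity of the reduction: up to sign, every coordinate with respect to
  \<open>ad_basis\<close> is one of the reduced entries.\<close>

lemma tensor_rel_iff_ad_red:
  fixes u :: "cmat \<Rightarrow>\<^sub>0 'k::field"
  assumes l: "1 \<le> l" and u: "u \<in> tensor_free (g_ad_int l)"
  shows "u \<in> tensor_rel (g_ad_int l) \<longleftrightarrow> (\<forall>i\<in>{1..2*l}. \<forall>j\<in>{1..2*l}. ad_red u i j = 0)"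
proof
  assume "u \<in> tensor_rel (g_ad_int l)"
  then show "\<forall>i\<in>{1..2*l}. \<forall>j\<in>{1..2*l}. ad_red u i j = 0"
    unfolding ad_red_def g_ad_int_eq[OF l]
    by (intro ballI, elim pm_eval_tensor_rel)
      (auto simp: shifted_add ad_lattice_def intro!: int_red_add)
next
  assume 0: "\<forall>i\<in>{1..2*l}. \<forall>j\<in>{1..2*l}. ad_red u i j = 0"
  have "\<forall>p\<in>upper l. pm_eval (\<lambda>x. of_int (ad_coord_int p x)) u = 0"
    using 0 l by (auto simp: pm_eval_ad_coord[OF l u] upper_def)
  moreover have "ad_coord_int p (x + y) = ad_coord_int p x + ad_coord_int p y"
    if "p \<in> upper l" "x \<in> ad_lattice l" "y \<in> ad_lattice l" for p x y
  proof -
    have "x + y \<in> ad_lattice l" using that im.subspace_add[OF subspace_ad_lattice] by blast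
    then have "complex_of_int (ad_coord_int p (x + y)) = of_int (ad_coord_int p x + ad_coord_int p y)"
      using that by (simp add: of_int_ad_coord_int[OF l] ad_coord_add)
    then show ?thesis by (simp only: of_int_eq_iff)
  qed
  ultimately show "u \<in> tensor_rel (g_ad_int l)"
    using u unfolding g_ad_int_eq[OF l]
    by (subst tensor_rel_iff_coords[OF im.module_axioms finite_upper subspace_ad_lattice, where \<beta> = "ad_basis l" and \<chi> = ad_coord_int])
      (auto intro: ad_basis_in_ad ad_lattice_expand[OF l])
qed

text \<open>\<open>mir\<close> says that \<open>X\<close> is the matrix of a similitude with
  multiplier \<open>X (2*l) (2*l)\<close>. Prescribing the coordinates fixes the reduction on
  \<open>upper l\<close> and in the last corner; the mirror rule does the rest.\<close>

lemma ad_red_surj: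
  fixes X :: "nat \<Rightarrow> nat \<Rightarrow> 'k::field"
  assumes l: "1 \<le> l" and c2: "CHAR('k) = 2" and X11: "X 1 1 = 0"
    and mir: "\<And>i j. i \<in> {1..2*l} \<Longrightarrow> j \<in> {1..2*l} \<Longrightarrow>
      X (mirror l j) (mirror l i) = X i j + (if i = j then X (2*l) (2*l) else 0)"
  obtains u where "u \<in> tensor_free (g_ad_int l)"
    and "\<And>i j. i \<in> {1..2*l} \<Longrightarrow> j \<in> {1..2*l} \<Longrightarrow> ad_red u i j = X i j"
proof -
  let ?c = "\<lambda>p. if p = (1, 1) then - X (2*l) (2*l) else X (fst p) (snd p)"
  define u where "u = (\<Sum>p\<in>upper l. Poly_Mapping.single (ad_basis l p) (?c p))"
  have u: "u \<in> tensor_free (g_ad_int l)"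
    unfolding u_def
    by (intro pm.subspace_sum[OF subspace_tensor_free])
      (auto simp: tensor_free_def g_ad_int_eq[OF l] ad_basis_in_ad)
  have coord: "pm_eval (\<lambda>x. of_int (ad_coord_int p x)) u = ?c p" if p: "p \<in> upper l" for p
  proof -
    have "complex_of_int (ad_coord_int p (ad_basis l q)) = of_int (if p = q then 1 else 0)"
      if "q \<in> upper l" for q
      using that p by (simp add: of_int_ad_coord_int[OF l ad_basis_in_ad] ad_coord_ad_basis[OF l])
    then have "ad_coord_int p (ad_basis l q) = (if p = q then 1 else 0)" if "q \<in> upper l" for q
      using that by (simp only: of_int_eq_iff)
    then have "pm_eval (\<lambda>x. of_int (ad_coord_int p x)) u = (\<Sum>q\<in>upper l. if p = q then ?c q else 0)"
      unfolding u_def pm_eval_sum by (intro sum.cong) auto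
    then show ?thesis using p finite_upper by simp
  qed
  have n: "ad_red u (2*l) (2*l) = X (2*l) (2*l)"
  proof -
    have "(1, 1) \<in> upper l" using l by (auto simp: upper_def)
    from coord[OF this] pm_eval_ad_coord[OF l u this] show ?thesis by simp
  qed
  have up: "ad_red u i j = X i j" if "(i, j) \<in> upper l" for i j
  proof (cases "(i, j) = (1, 1)")
    case True
    then show ?thesis using X11 by simp
  next
    case False
    then show ?thesis
      using coord[OF that] pm_eval_ad_coord[OF l u that] unfolding if_not_P[OF False] by simp
  qed
  have "ad_red u i j = X i j" if i: "i \<in> {1..2*l}" and j: "j \<in> {1..2*l}" for i j
    using upper_or_mirror[OF i j]
  proof
    assume "(mirror l j, mirror l i) \<in> upper l"
    from up[OF this] show ?thesis
      using ad_red_mirror[OF l c2 u i j] mir[OF i j] n by (cases "i = j") auto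
  qed (rule up)
  with u show ?thesis by (rule that)
qed

lemma sc_red_surj:
  fixes M :: "nat \<Rightarrow> nat \<Rightarrow> 'k::field"
  assumes l: "1 \<le> l" and c2: "CHAR('k) = 2"
    and mir: "\<And>i j. i \<in> {1..2*l} \<Longrightarrow> j \<in> {1..2*l} \<Longrightarrow> M (mirror l j) (mirror l i) = M i j"
  obtains s where "s \<in> tensor_free (g_int l)"
    and "\<And>i j. i \<in> {1..2*l} \<Longrightarrow> j \<in> {1..2*l} \<Longrightarrow> sc_red s i j = M i j"
proof -
  define s where "s = (\<Sum>p\<in>upper l. Poly_Mapping.single (root_elt l (fst p) (snd p)) (M (fst p) (snd p)))"
  have s: "s \<in> tensor_free (g_int l)"
    unfolding s_def
    by (intro pm.subspace_sum[OF subspace_tensor_free])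
      (auto simp: tensor_free_def upper_def intro!: root_elt_in_g_int[OF l])
  have up: "sc_red s i j = M i j" if ij: "(i, j) \<in> upper l" for i j
  proof -
    have "sc_red s i j = (\<Sum>q\<in>upper l. if (i, j) = q then M i j else 0)"
      unfolding sc_red_def s_def pm_eval_sum
      by (intro sum.cong refl) (auto simp: root_elt_upper[OF ij] split: prod.splits)
    then show ?thesis using ij finite_upper by simp
  qed
  have "sc_red s i j = M i j" if i: "i \<in> {1..2*l}" and j: "j \<in> {1..2*l}" for i j
    using upper_or_mirror[OF i j]
  proof
    assume "(mirror l j, mirror l i) \<in> upper l"
    from up[OF this] show ?thesis
      using sc_red_mirror[OF l c2 s i j] mir[OF i j] by simp
  qed (rule up)
  with s show ?thesis by (rule that)
qed

section \<open>Symplectic spaces in characteristic two\<close>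

lemma sum_fun_apply: "(\<Sum>p\<in>A. f p) x = (\<Sum>p\<in>A. f p x)"
  by (induction A rule: infinite_finite_induct) auto

locale char2_symplectic = vector_space scale
  for scale :: "'k::field \<Rightarrow> 'v::ab_group_add \<Rightarrow> 'v" (infixr \<open>*s\<close> 75) +
  fixes b :: "'v \<Rightarrow> 'v \<Rightarrow> 'k"
  assumes char_two: "CHAR('k) = 2"
    and form: "nondeg_alternating scale b"
begin

abbreviation lin :: "('v \<Rightarrow> 'v) \<Rightarrow> bool" where
  "lin \<equiv> Vector_Spaces.linear scale scale"

lemma lin_iff: "lin f \<longleftrightarrow> (\<forall>x y. f (x + y) = f x + f y) \<and> (\<forall>c x. f (c *s x) = c *s f x)"
  using vector_space_axioms by (simp add: Vector_Spaces.linear_iff)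

lemma lin_sum: "lin f \<Longrightarrow> f (\<Sum>i\<in>A. g i) = (\<Sum>i\<in>A. f (g i))"
  using module_hom.sum[of scale scale f] by (simp add: module_hom_iff_linear)

lemma b_linear: "Vector_Spaces.linear scale (*) (b x)" "Vector_Spaces.linear scale (*) (\<lambda>x. b x y)"
  using form by (auto simp: nondeg_alternating_def)

lemma b_add_scale [simp]:
  "b (x + y) z = b x z + b y z" "b z (x + y) = b z x + b z y"
  "b (c *s x) y = c * b x y" "b x (c *s y) = c * b x y"
  using b_linear(1)[of x] b_linear(1)[of z] b_linear(2)[of y] b_linear(2)[of z]
  unfolding Vector_Spaces.linear_iff by blast+

lemma b_zero_minus [simp]:
  "b 0 x = 0" "b x 0 = 0" "b (- x) y = - b x y" "b x (- y) = - b x y"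
  "b (x - y) z = b x z - b y z" "b z (x - y) = b z x - b z y"
proof -
  show 0: "b 0 x = 0" "b x 0 = 0" for x
    using b_add_scale(3)[of 0 0 x] b_add_scale(4)[of x 0 0] by simp_all
  show m: "b (- x) y = - b x y" "b x (- y) = - b x y" for x y
    using b_add_scale(1)[of "- x" x y] b_add_scale(2)[of x "- y" y] 0
    by (simp_all add: eq_neg_iff_add_eq_0)
  show "b (x - y) z = b x z - b y z" "b z (x - y) = b z x - b z y"
    unfolding diff_conv_add_uminus by (simp_all only: b_add_scale m)
qed

lemma b_sum: "b (sum f A) y = (\<Sum>i\<in>A. b (f i) y)" "b y (sum f A) = (\<Sum>i\<in>A. b y (f i))"
  by (induction A rule: infinite_finite_induct) auto

lemma b_self [simp]: "b x x = 0"
  using form by (simp add: nondeg_alternating_def)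

lemma b_commute: "b x y = b y x"
proof -
  have "b x y + b y x = 0"
    using b_self[of "x + y"] unfolding b_add_scale by (simp add: add.commute)
  then show ?thesis using char_two_minus[OF char_two] by (metis minus_unique)
qed

lemma char2 [simp]: "x + x = (0::'k)" "- x = (x::'k)" "(2::'k) = 0"
  using char_two_add_self[OF char_two] char_two_minus[OF char_two] char_two_add_self[OF char_two, of 1]
  by auto

text \<open>The Lie algebra of the similitude group, with \<open>c\<close> the multiplier. The
  identity has multiplier \<open>2 = 0\<close>, so here the scalars lie in \<open>sp(V)\<close>
  itself.\<close>

definition similitude :: "'k \<Rightarrow> ('v \<Rightarrow> 'v) \<Rightarrow> bool" where
  "similitude c x \<longleftrightarrow> lin x \<and> (\<forall>u w. b (x u) w + b u (x w) = c * b u w)"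

lemma sp_eq: "sp scale b = {x. similitude 0 x}"
  by (simp add: sp_def similitude_def)

abbreviation endo_scale :: "'k \<Rightarrow> ('v \<Rightarrow> 'v) \<Rightarrow> 'v \<Rightarrow> 'v" where
  "endo_scale \<equiv> \<lambda>c x u. c *s x u"

sublocale endo: vector_space endo_scale
  by unfold_locales (auto simp: fun_eq_iff scale_right_distrib scale_left_distrib)

definition scalar_commuting :: "('v \<Rightarrow> 'v) \<Rightarrow> 'k \<Rightarrow> ('v \<Rightarrow> 'v) \<Rightarrow> bool" where
  "scalar_commuting e d x \<longleftrightarrow> (\<forall>u. e (x u) - x (e u) = d *s u)"

lemma similitude_add: "similitude c x \<Longrightarrow> similitude d y \<Longrightarrow> similitude (c + d) (x + y)"
  by (auto simp: similitude_def lin_iff scale_right_distrib algebra_simps)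

lemma similitude_scale: "similitude c x \<Longrightarrow> similitude (a * c) (endo_scale a x)"
  by (auto simp: similitude_def lin_iff scale_right_distrib algebra_simps) (metis distrib_left)

lemma scalar_commuting_add:
  "lin e \<Longrightarrow> scalar_commuting e c x \<Longrightarrow> scalar_commuting e d y \<Longrightarrow> scalar_commuting e (c + d) (x + y)"
  unfolding scalar_commuting_def lin_iff by (simp add: scale_left_distrib) (metis add_diff_add)

lemma scalar_commuting_scale:
  "lin e \<Longrightarrow> scalar_commuting e c x \<Longrightarrow> scalar_commuting e (a * c) (endo_scale a x)"
  unfolding scalar_commuting_def lin_iff by (metis scale_scale scale_right_diff_distrib)

end

section \<open>Coordinates in a basis paired by an involution\<close>

text \<open>The index set is kept general in order to cover both the standard basis and the union of
  the bases of all blocks of a decomposition.\<close>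

locale char2_gram = char2_symplectic +
  fixes A :: "'i set" and \<sigma> :: "'i \<Rightarrow> 'i" and v :: "'i \<Rightarrow> 'b"
  assumes finA: "finite A"
    and \<sigma>_in: "i \<in> A \<Longrightarrow> \<sigma> i \<in> A"
    and \<sigma>_\<sigma>: "i \<in> A \<Longrightarrow> \<sigma> (\<sigma> i) = i"
    and gram: "i \<in> A \<Longrightarrow> j \<in> A \<Longrightarrow> b (v i) (v j) = (if j = \<sigma> i then 1 else 0)"
    and spans: "span (v ` A) = UNIV"
begin

lemma gram': "i \<in> A \<Longrightarrow> j \<in> A \<Longrightarrow> b (v i) (v (\<sigma> j)) = (if i = j then 1 else 0)"
  using gram \<sigma>_in \<sigma>_\<sigma> by metis

lemma lin_eqI:
  assumes "lin f" "lin g" "\<And>i. i \<in> A \<Longrightarrow> f (v i) = g (v i)"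
  shows "f = g"
proof
  fix x
  have f: "f (c *s x + y) = c *s f x + f y" and g: "g (c *s x + y) = c *s g x + g y" for c x y
    using assms(1,2) by (simp_all add: lin_iff)
  have 0: "f 0 = 0" "g 0 = 0" using lin_sum[OF assms(1), of id "{}"] lin_sum[OF assms(2), of id "{}"] by auto
  have "x \<in> span (v ` A)" using spans by simp
  then show "f x = g x"
  proof (induction rule: span_induct_alt)
    case (step c x y)
    then show ?case using assms(3) f g by auto
  qed (simp add: 0)
qed

text \<open>Linear extension of \<open>a\<close> from the basis: the coordinate of \<open>w\<close>
  at \<open>i\<close> is its pairing with the dual vector \<open>v (\<sigma> i)\<close>.\<close>

definition ext :: "('i \<Rightarrow> 'b) \<Rightarrow> 'b \<Rightarrow> 'b" where
  "ext a w = (\<Sum>i\<in>A. b w (v (\<sigma> i)) *s a i)"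

lemma lin_ext: "lin (ext a)"
  by (simp add: lin_iff ext_def scale_left_distrib sum.distrib scale_sum_right)

lemma ext_v: "j \<in> A \<Longrightarrow> ext a (v j) = a j"
  using finA by (simp add: ext_def gram' if_distrib[of "\<lambda>t. t *s _"] sum.delta' cong: if_cong)

lemma similitudeI:
  assumes x: "lin x"
    and *: "\<And>i j. i \<in> A \<Longrightarrow> j \<in> A \<Longrightarrow> b (x (v i)) (v j) + b (v i) (x (v j)) = c * b (v i) (v j)"
  shows "similitude c x"
  unfolding similitude_def
proof (intro conjI allI x)
  fix u w
  have x': "x (y + z) = x y + x z" "x (d *s y) = d *s x y" for y z d
    using x by (auto simp: lin_iff)
  have x0: "x 0 = 0" using x'(2)[of 0 0] by simp
  have 1: "b (x (v i)) w + b (v i) (x w) = c * b (v i) w" if i: "i \<in> A" for i w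
  proof -
    have "w \<in> span (v ` A)" using spans by simp
    then show ?thesis
    proof (induction rule: span_induct_alt)
      case (step d y z)
      then obtain j where j: "j \<in> A" "y = v j" by blast
      have eq: "b (x (v i)) (d *s y + z) + b (v i) (x (d *s y + z)) =
        d * (b (x (v i)) (v j) + b (v i) (x (v j))) + (b (x (v i)) z + b (v i) (x z))"
        by (simp add: x' j(2) algebra_simps)
      show ?case unfolding eq *[OF i j(1)] step(2) by (simp add: j(2) algebra_simps)
    qed (simp add: x0)
  qed
  have "u \<in> span (v ` A)" using spans by simp
  then show "b (x u) w + b u (x w) = c * b u w"
  proof (induction rule: span_induct_alt)
    case (step d y z)
    then obtain j where j: "j \<in> A" "y = v j" by blast
    have eq: "b (x (d *s y + z)) w + b (d *s y + z) (x w) =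
      d * (b (x (v j)) w + b (v j) (x w)) + (b (x z) w + b z (x w))"
      by (simp add: x' j(2) algebra_simps)
    show ?case unfolding eq 1[OF j(1)] step(2) by (simp add: j(2) algebra_simps)
  qed (simp add: x0)
qed

lemma scalar_commutingI:
  assumes "lin e" "lin x" "\<And>i. i \<in> A \<Longrightarrow> e (x (v i)) - x (e (v i)) = d *s v i"
  shows "scalar_commuting e d x"
proof -
  have "(\<lambda>u. e (x u) - x (e u)) = (\<lambda>u. d *s u)"
    using assms by (intro lin_eqI) (auto simp: lin_iff algebra_simps)
  then show ?thesis by (metis scalar_commuting_def)
qed

definition entry :: "('b \<Rightarrow> 'b) \<Rightarrow> 'i \<Rightarrow> 'i \<Rightarrow> 'a" where
  "entry x i j = b (x (v j)) (v (\<sigma> i))"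

definition endo_of :: "('i \<Rightarrow> 'i \<Rightarrow> 'a) \<Rightarrow> 'b \<Rightarrow> 'b" where
  "endo_of M = ext (\<lambda>j. \<Sum>i\<in>A. M i j *s v i)"

lemma expand: "w = (\<Sum>i\<in>A. b w (v (\<sigma> i)) *s v i)"
proof -
  have "ext v = (\<lambda>w. w)" by (rule lin_eqI[OF lin_ext]) (simp add: lin_iff, simp add: ext_v)
  then show ?thesis by (metis ext_def)
qed

lemma lin_endo_of: "lin (endo_of M)"
  by (simp add: endo_of_def lin_ext)

lemma entry_endo_of: "i \<in> A \<Longrightarrow> j \<in> A \<Longrightarrow> entry (endo_of M) i j = M i j"
  using finA by (simp add: entry_def endo_of_def ext_v b_sum gram' if_distrib[of "\<lambda>t. _ * t"] sum.delta'
      cong: if_cong)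

lemma entry_sum: "x (v j) = (\<Sum>i\<in>A. entry x i j *s v i)"
  unfolding entry_def by (rule expand)

lemma lin_eq_entryI:
  assumes "lin x" "lin y" "\<And>i j. i \<in> A \<Longrightarrow> j \<in> A \<Longrightarrow> entry x i j = entry y i j"
  shows "x = y"
proof (rule lin_eqI[OF assms(1,2)])
  fix j assume j: "j \<in> A"
  show "x (v j) = y (v j)"
    unfolding entry_sum[of x] entry_sum[of y] using assms(3) j by simp
qed

lemma entry_comp: "lin x \<Longrightarrow> entry (\<lambda>u. x (y u)) i j = (\<Sum>k\<in>A. entry x i k * entry y k j)"
  unfolding entry_def
  by (subst entry_sum[of y]) (simp add: lin_sum b_sum lin_iff entry_def mult.commute)

text \<open>Matrix units span. This supplies the finite dimension that the kernel count
  requires.\<close>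

lemma lin_in_finite_span: "\<exists>W. finite W \<and> {x. lin x} \<subseteq> endo.span W"
proof (intro exI conjI)
  let ?U = "\<lambda>(i, j). endo_of (\<lambda>a c. if a = i \<and> c = j then 1 else 0)"
  show "finite (?U ` (A \<times> A))" using finA by simp
  show "{x. lin x} \<subseteq> endo.span (?U ` (A \<times> A))"
  proof
    fix x assume "x \<in> {x. lin x}"
    then have x: "lin x" by simp
    have "x = (\<Sum>p\<in>A \<times> A. endo_scale (entry x (fst p) (snd p)) (?U p))" (is "_ = ?y")
    proof (rule lin_eq_entryI[OF x])
      have y: "?y u = (\<Sum>p\<in>A \<times> A. entry x (fst p) (snd p) *s ?U p u)" for u
        by (rule sum_fun_apply)
      have "lin (\<lambda>u. \<Sum>p\<in>A \<times> A. entry x (fst p) (snd p) *s ?U p u)"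
        using lin_endo_of by (auto simp: lin_iff sum.distrib scale_right_distrib scale_sum_right mult.commute
            split_beta)
      then show "lin ?y" using y by presburger
      fix i j assume ij: "i \<in> A" "j \<in> A"
      have "entry ?y i j = (\<Sum>p\<in>A \<times> A. entry x (fst p) (snd p) * entry (?U p) i j)"
        by (simp only: entry_def[of ?y] y) (simp add: b_sum entry_def)
      also have "\<dots> = (\<Sum>p\<in>A \<times> A. if p = (i, j) then entry x i j else 0)"
        using ij by (intro sum.cong refl) (auto simp: entry_endo_of split: if_splits)
      finally show "entry x i j = entry ?y i j" using finA ij by simp
    qed
    also have "\<dots> \<in> endo.span (?U ` (A \<times> A))"
      by (intro endo.span_sum endo.span_scale endo.span_base) auto
    finally show "x \<in> endo.span (?U ` (A \<times> A))" .
  qed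
qed

end

section \<open>The adjoint fixed space as similitudes modulo scalars\<close>

locale char2_standard = char2_symplectic +
  fixes l :: nat and v :: "nat \<Rightarrow> 'b"
  assumes l_pos: "1 \<le> l" and basis: "antidiag_basis scale b l v UNIV"

sublocale char2_standard \<subseteq> char2_gram scale b "{1..2*l}" "mirror l" v
proof
  fix i j assume "i \<in> {1..2*l}" "j \<in> {1..2*l}"
  then show "b (v i) (v j) = (if j = mirror l i then 1 else 0)"
    using basis by (auto simp: antidiag_basis_def mirror_def)
qed (use basis in \<open>auto simp: antidiag_basis_def mirror_def\<close>)

context char2_standard
begin

declare One_nat_def [simp del]

text \<open>The preimage of \<open>g_ad^e\<close> in the similitude algebra: being annihilated
  modulo scalars means that \<open>[e, x]\<close> is a scalar.\<close>

definition mod_scalar_fixed :: "('b \<Rightarrow> 'b) \<Rightarrow> ('b \<Rightarrow> 'b) set" where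
  "mod_scalar_fixed e = {x. (\<exists>c. similitude c x) \<and> (\<exists>d. scalar_commuting e d x)}"

lemma one_in: "1 \<in> {1..2*l}"
  using l_pos by simp

lemma b_1_last: "b (v 1) (v (mirror l 1)) = 1"
  using gram[OF one_in mirror_in[OF one_in]] by simp

lemma similitude_unique: "similitude c x \<Longrightarrow>
  b (x (v 1)) (v (mirror l 1)) + b (v 1) (x (v (mirror l 1))) = c"
  using b_1_last by (simp add: similitude_def)

lemma scalar_commuting_unique: "scalar_commuting e d x \<Longrightarrow>
  b (e (x (v 1)) - x (e (v 1))) (v (mirror l 1)) = d"
  using b_1_last by (simp add: scalar_commuting_def)

lemma dim_mod_scalar_fixed:
  assumes e: "lin e"
  shows "endo.dim {x \<in> mod_scalar_fixed e. entry x 1 1 = 0} + 1 =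
    dim_gsc_fixed scale b e
    + (if \<exists>c x. c \<noteq> 0 \<and> similitude c x \<and> scalar_commuting e 0 x then 1 else 0)
    + (if \<exists>c d x. d \<noteq> 0 \<and> similitude c x \<and> scalar_commuting e d x then 1 else 0)"
proof -
  let ?G = "mod_scalar_fixed e"
  \<comment> \<open>All three functionals are read off at the dual pair \<open>v 1\<close>,
    \<open>v (mirror l 1)\<close>, on which the form is 1: \<open>?\<tau>\<close> normalises modulo
    scalars, \<open>?\<mu>\<close> is the multiplier, \<open>?\<delta>\<close> the scalar
    \<open>[e, x]\<close>.\<close>
  let ?\<tau> = "\<lambda>x. entry x 1 1"
  let ?\<mu> = "\<lambda>x. b (x (v 1)) (v (mirror l 1)) + b (v 1) (x (v (mirror l 1)))"
  let ?\<delta> = "\<lambda>x. b (e (x (v 1)) - x (e (v 1))) (v (mirror l 1))"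
  have sim0: "similitude 0 0" and com0: "scalar_commuting e 0 0"
    using e by (auto simp: similitude_def scalar_commuting_def lin_iff) (metis scale_zero_left)
  have subG: "endo.subspace ?G"
    unfolding mod_scalar_fixed_def
    by (intro endo.subspaceI)
      (use sim0 com0 similitude_add similitude_scale scalar_commuting_add[OF e]
        scalar_commuting_scale[OF e] in blast)+
  obtain W where W: "finite W" "{x. lin x} \<subseteq> endo.span W" using lin_in_finite_span by blast
  have linG: "lin x" if "x \<in> ?G" for x using that by (auto simp: mod_scalar_fixed_def similitude_def)
  then have GW: "?G \<subseteq> endo.span W" using W(2) by blast
  let ?C = "{x \<in> ?G. ?\<delta> x = 0}"
  have \<tau>: "endo.dim ?G = endo.dim {x \<in> ?G. ?\<tau> x = 0} + (if \<exists>x\<in>?G. ?\<tau> x \<noteq> 0 then 1 else 0)"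
    by (rule endo.dim_kernel_functional[OF subG GW W(1)]) (simp_all add: entry_def)
  have ee: "e (x + y) = e x + e y" "e (c *s x) = c *s e x" for x y c
    using e by (auto simp: lin_iff)
  have \<delta>: "endo.dim ?G = endo.dim ?C + (if \<exists>x\<in>?G. ?\<delta> x \<noteq> 0 then 1 else 0)"
    by (rule endo.dim_kernel_functional[OF subG GW W(1)]) (simp_all add: ee algebra_simps)
  have subC: "endo.subspace ?C"
  proof (rule endo.subspaceI)
    have "e 0 = 0" using ee(2)[of 0 0] by simp
    then show "0 \<in> ?C" using endo.subspace_0[OF subG] by simp
    show "x + y \<in> ?C" if "x \<in> ?C" "y \<in> ?C" for x y
      using endo.subspace_add[OF subG, of x y] that by (simp add: ee)
    show "endo_scale c x \<in> ?C" if "x \<in> ?C" for c x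
      using endo.subspace_scale[OF subG, of x c] that
      by (simp add: ee flip: right_diff_distrib)
  qed
  \<comment> \<open>The multiplier is taken on the kernel of \<open>?\<delta>\<close>. Hence its
    criterion concerns only \<open>x\<close> commuting with \<open>e\<close>, while the criterion
    for \<open>?\<delta>\<close> allows any multiplier.\<close>
  have \<mu>: "endo.dim ?C = endo.dim {x \<in> ?C. ?\<mu> x = 0} + (if \<exists>x\<in>?C. ?\<mu> x \<noteq> 0 then 1 else 0)"
    by (rule endo.dim_kernel_functional[OF subC _ W(1)]) (use GW in \<open>auto simp: algebra_simps\<close>)
  have C: "?C = {x. (\<exists>c. similitude c x) \<and> scalar_commuting e 0 x}"
  proof (intro equalityI subsetI)
    fix x assume "x \<in> ?C"
    then obtain c d where x: "similitude c x" "scalar_commuting e d x" and "?\<delta> x = 0"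
      unfolding mod_scalar_fixed_def by blast
    then have "d = 0" using scalar_commuting_unique[OF x(2)] by argo
    with x show "x \<in> {x. (\<exists>c. similitude c x) \<and> scalar_commuting e 0 x}" by blast
  next
    fix x assume "x \<in> {x. (\<exists>c. similitude c x) \<and> scalar_commuting e 0 x}"
    then show "x \<in> ?C" unfolding mod_scalar_fixed_def using scalar_commuting_unique by blast
  qed
  have S: "{x \<in> ?C. ?\<mu> x = 0} = sp_centralizer scale b e"
    unfolding C sp_centralizer_def sp_eq using similitude_unique
    by (auto simp: scalar_commuting_def)
  \<comment> \<open>The identity shows that \<open>?\<tau>\<close> never vanishes on all of
    \<open>?G\<close>; this is the constant \<open>+ 1\<close> on the left-hand side.\<close>
  have "(\<lambda>x. x) \<in> ?G"
    unfolding mod_scalar_fixed_def similitude_def scalar_commuting_def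
    by (auto simp: lin_iff intro!: exI[of _ 0] simp del: char2)
  moreover have "?\<tau> (\<lambda>x. x) = 1" using b_1_last by (simp add: entry_def)
  ultimately have t: "\<exists>x\<in>?G. ?\<tau> x \<noteq> 0" by (metis zero_neq_one)
  have m: "(\<exists>x\<in>?C. ?\<mu> x \<noteq> 0) \<longleftrightarrow> (\<exists>c x. c \<noteq> 0 \<and> similitude c x \<and> scalar_commuting e 0 x)"
    unfolding C using similitude_unique by blast
  have d: "(\<exists>x\<in>?G. ?\<delta> x \<noteq> 0) \<longleftrightarrow> (\<exists>c d x. d \<noteq> 0 \<and> similitude c x \<and> scalar_commuting e d x)"
    unfolding mod_scalar_fixed_def using scalar_commuting_unique by blast
  show ?thesis
    using \<tau> \<delta> \<mu> t unfolding m d S dim_gsc_fixed_def by simp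
qed

text \<open>Identifies the tensor product over \<open>g_ad_int l\<close> with the similitudes whose
  entry at \<open>(1, 1)\<close> is zero, a complement of the scalars.\<close>

definition red_endo :: "(cmat \<Rightarrow>\<^sub>0 'a) \<Rightarrow> 'b \<Rightarrow> 'b" where
  "red_endo u = endo_of (ad_red u)"

lemma lin_red_endo: "lin (red_endo u)"
  unfolding red_endo_def by (rule lin_endo_of)

lemma entry_red_endo: "i \<in> {1..2*l} \<Longrightarrow> j \<in> {1..2*l} \<Longrightarrow> entry (red_endo u) i j = ad_red u i j"
  unfolding red_endo_def by (rule entry_endo_of)

lemma linear_red_endo: "Vector_Spaces.linear pm_scale endo_scale red_endo"
proof -
  have "lin (red_endo u + red_endo w)" "lin (endo_scale c (red_endo u))" for u w c
    using lin_red_endo by (simp_all add: lin_iff scale_right_distrib algebra_simps)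
  then have "red_endo (u + w) = red_endo u + red_endo w" "red_endo (pm_scale c u) = endo_scale c (red_endo u)" for u w c
    by (auto intro!: lin_eq_entryI[OF lin_red_endo] simp: entry_red_endo ad_red_add ad_red_scale)
      (simp_all add: entry_def entry_red_endo[unfolded entry_def] del: One_nat_def)
  then show ?thesis
    using vector_space_pm_scale endo.vector_space_axioms by (simp add: Vector_Spaces.linear_iff)
qed

lemma red_endo_eq_0_iff:
  assumes "u \<in> tensor_free (g_ad_int l)"
  shows "red_endo u = 0 \<longleftrightarrow> u \<in> tensor_rel (g_ad_int l)"
proof -
  have "red_endo u = 0 \<longleftrightarrow> (\<forall>i\<in>{1..2*l}. \<forall>j\<in>{1..2*l}. ad_red u i j = 0)"
  proof
    assume "red_endo u = 0"
    then show "\<forall>i\<in>{1..2*l}. \<forall>j\<in>{1..2*l}. ad_red u i j = 0"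
      using entry_red_endo[of _ _ u] by (auto simp: entry_def)
  next
    assume "\<forall>i\<in>{1..2*l}. \<forall>j\<in>{1..2*l}. ad_red u i j = 0"
    then show "red_endo u = 0"
      by (intro lin_eq_entryI[OF lin_red_endo]) (auto simp: entry_red_endo lin_iff entry_def[of 0])
  qed
  then show ?thesis using tensor_rel_iff_ad_red[OF l_pos assms] by simp
qed

lemma similitude_red_endo:
  assumes u: "u \<in> tensor_free (g_ad_int l)"
  shows "similitude (ad_red u (2*l) (2*l)) (red_endo u)"
proof (rule similitudeI[OF lin_red_endo])
  fix i j assume i: "i \<in> {1..2*l}" and j: "j \<in> {1..2*l}"
  let ?x = "red_endo u"
  have 1: "b (?x (v i)) (v j) = ad_red u (mirror l j) i"
    using entry_red_endo[OF mirror_in[OF j] i, of u] j by (simp add: entry_def)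
  have 2: "b (v i) (?x (v j)) = ad_red u (mirror l i) j"
    using entry_red_endo[OF mirror_in[OF i] j, of u] i by (simp add: entry_def b_commute)
  have "ad_red u (mirror l j) i = ad_red u (mirror l i) j
      + (if mirror l i = j then ad_red u (2*l) (2*l) else 0)"
    using ad_red_mirror[OF l_pos char_two u mirror_in[OF i] j] i by simp
  then show "b (?x (v i)) (v j) + b (v i) (?x (v j)) = ad_red u (2*l) (2*l) * b (v i) (v j)"
    using gram[OF i j] unfolding 1 2 by (auto simp: add.commute)
qed

lemma entry_mirror:
  assumes x: "similitude c x" and i: "i \<in> {1..2*l}" and j: "j \<in> {1..2*l}"
  shows "entry x (mirror l j) (mirror l i) = entry x i j + (if i = j then c else 0)"
proof -
  have "b (x (v (mirror l i))) (v j) + b (v (mirror l i)) (x (v j)) = c * b (v (mirror l i)) (v j)"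
    using x by (simp add: similitude_def)
  then have "b (x (v (mirror l i))) (v j) = - b (v (mirror l i)) (x (v j)) + c * b (v (mirror l i)) (v j)"
    by (simp add: algebra_simps del: char2)
  moreover have "b (v (mirror l i)) (v j) = (if i = j then 1 else 0)"
    using gram'[OF j i] by (auto simp: b_commute)
  ultimately show ?thesis using i j by (simp add: entry_def b_commute[of "v (mirror l i)"])
qed

lemma red_endo_surj:
  assumes x: "similitude c x" and 11: "entry x 1 1 = 0"
  obtains u where "u \<in> tensor_free (g_ad_int l)" "red_endo u = x"
proof -
  \<comment> \<open>As the first corner vanishes, the opposite one carries the multiplier, which is
    the shape that \<open>ad_red_surj\<close> expects.\<close>
  have "entry x (mirror l 1) (mirror l 1) = c" using entry_mirror[OF x one_in one_in] 11 by simp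
  then have n: "entry x (2*l) (2*l) = c" by (simp add: mirror_def)
  obtain u where u: "u \<in> tensor_free (g_ad_int l)"
    "\<And>i j. i \<in> {1..2*l} \<Longrightarrow> j \<in> {1..2*l} \<Longrightarrow> ad_red u i j = entry x i j"
    using ad_red_surj[OF l_pos char_two, of "entry x"] 11 entry_mirror[OF x] unfolding n by metis
  have "red_endo u = x"
    using x by (intro lin_eq_entryI[OF lin_red_endo]) (auto simp: entry_red_endo u(2) similitude_def)
  with u(1) show ?thesis by (rule that)
qed

lemma represents_iff:
  assumes e: "lin e"
  shows "represents scale l v s e \<longleftrightarrow>
    s \<in> tensor_free (g_int l) \<and> (\<forall>i\<in>{1..2*l}. \<forall>j\<in>{1..2*l}. sc_red s i j = entry e i j)"
proof -
  have "(\<forall>j\<in>{1..2*l}. e (v j) = (\<Sum>i=1..2*l. sc_red s i j *s v i)) \<longleftrightarrow>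
    (\<forall>i\<in>{1..2*l}. \<forall>j\<in>{1..2*l}. sc_red s i j = entry e i j)"
  proof
    assume *: "\<forall>j\<in>{1..2*l}. e (v j) = (\<Sum>i=1..2*l. sc_red s i j *s v i)"
    have "e = endo_of (sc_red s)"
      by (rule lin_eqI[OF e lin_endo_of]) (use * in \<open>simp add: endo_of_def ext_v\<close>)
    then show "\<forall>i\<in>{1..2*l}. \<forall>j\<in>{1..2*l}. sc_red s i j = entry e i j"
      by (auto simp: entry_endo_of)
  next
    assume *: "\<forall>i\<in>{1..2*l}. \<forall>j\<in>{1..2*l}. sc_red s i j = entry e i j"
    then show "\<forall>j\<in>{1..2*l}. e (v j) = (\<Sum>i=1..2*l. sc_red s i j *s v i)"
      by (subst entry_sum[of e]) simp
  qed
  then show ?thesis by (simp add: represents_def sc_red_def pm_eval_def)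
qed

text \<open>\<open>gad_fixed\<close> quantifies over all representatives of \<open>e\<close>;
  without one its condition would be vacuous.\<close>

lemma represents_exists:
  assumes e: "similitude 0 e"
  obtains s where "represents scale l v s e"
proof -
  have "lin e" using e by (simp add: similitude_def)
  moreover obtain s where "s \<in> tensor_free (g_int l)"
    "\<And>i j. i \<in> {1..2*l} \<Longrightarrow> j \<in> {1..2*l} \<Longrightarrow> sc_red s i j = entry e i j"
    using sc_red_surj[OF l_pos char_two, of "entry e"] entry_mirror[OF e] by (metis add.right_neutral)
  ultimately show ?thesis using that represents_iff by blast
qed

text \<open>Modulo \<open>tensor_rel\<close> the commutator is seen only after subtracting its
  \<open>(1, 1)\<close> entry on the diagonal, so its class vanishes exactly when it is a scalar
  matrix.\<close>

lemma bracket_in_rel_iff: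
  assumes e: "lin e" and s: "represents scale l v s e" and u: "u \<in> tensor_free (g_ad_int l)"
  shows "tensor_bracket (2*l) s u \<in> tensor_rel (g_ad_int l) \<longleftrightarrow> (\<exists>d. scalar_commuting e d (red_endo u))"
proof -
  let ?x = "red_endo u" and ?I = "{1..2*l}"
  let ?y = "\<lambda>w. e (?x w) - ?x (e w)"
  note x = lin_red_endo[of u]
  have s': "s \<in> tensor_free (g_int l)" "\<And>i j. i \<in> ?I \<Longrightarrow> j \<in> ?I \<Longrightarrow> sc_red s i j = entry e i j"
    using s represents_iff[OF e] by auto
  have C: "(\<Sum>k=1..2*l. sc_red s i k * ad_red u k j - ad_red u i k * sc_red s k j) = entry ?y i j"
    if "i \<in> ?I" "j \<in> ?I" for i j
  proof -
    have "entry ?y i j = entry (\<lambda>w. e (?x w)) i j - entry (\<lambda>w. ?x (e w)) i j"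
      by (simp add: entry_def)
    then show ?thesis
      unfolding entry_comp[OF e, of ?x] entry_comp[OF x, of e] sum_subtractf[symmetric]
      using that by (simp add: s'(2) entry_red_endo)
  qed
  have "tensor_bracket (2*l) s u \<in> tensor_rel (g_ad_int l) \<longleftrightarrow>
    (\<forall>i\<in>?I. \<forall>j\<in>?I. entry ?y i j = (if i = j then entry ?y 1 1 else 0))"
    unfolding tensor_rel_iff_ad_red[OF l_pos tensor_bracket_free[OF l_pos s'(1) u]]
    by (intro ball_cong refl)
      (simp only: ad_red_bracket[OF l_pos s'(1) u] C one_in right_minus_eq)
  also have "\<dots> \<longleftrightarrow> (\<exists>d. scalar_commuting e d ?x)"
  proof
    have sc: "entry (\<lambda>w. d *s w) i j = (if i = j then d else 0)" if "i \<in> ?I" "j \<in> ?I" for i j d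
      using gram'[OF that(2,1)] by (auto simp: entry_def)
    {
      define d where "d = entry ?y 1 1"
      assume "\<forall>i\<in>?I. \<forall>j\<in>?I. entry ?y i j = (if i = j then entry ?y 1 1 else 0)"
      then have *: "entry ?y i j = (if i = j then d else 0)" if "i \<in> ?I" "j \<in> ?I" for i j
        using that unfolding d_def by blast
      have "?y = (\<lambda>w. d *s w)"
      proof (rule lin_eq_entryI)
        show "lin ?y" "lin (\<lambda>w. d *s w)"
          using e x by (simp_all add: lin_iff algebra_simps scale_right_diff_distrib)
      qed (simp only: * sc)
      then show "\<exists>d. scalar_commuting e d ?x" unfolding scalar_commuting_def by metis
    }
    assume "\<exists>d. scalar_commuting e d ?x"
    then obtain d where d: "?y = (\<lambda>w. d *s w)" by (auto simp: scalar_commuting_def)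
    show "\<forall>i\<in>?I. \<forall>j\<in>?I. entry ?y i j = (if i = j then entry ?y 1 1 else 0)"
      unfolding d using sc one_in by (simp del: One_nat_def)
  qed
  finally show ?thesis .
qed

lemma dim_gad_fixed_eq:
  assumes e: "similitude 0 e"
  shows "dim_gad_fixed scale l v e = endo.dim {x \<in> mod_scalar_fixed e. entry x 1 1 = 0}"
proof -
  have e': "lin e" using e by (simp add: similitude_def)
  let ?L = "g_ad_int l" and ?U = "gad_fixed scale l v e"
  obtain s where s: "represents scale l v s e" using represents_exists[OF e] .
  have U: "?U = {u \<in> tensor_free ?L. \<exists>d. scalar_commuting e d (red_endo u)}"
    unfolding gad_fixed_def using bracket_in_rel_iff[OF e'] s by blast
  interpret F: Vector_Spaces.linear pm_scale endo_scale red_endo by (rule linear_red_endo)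
  have free: "tensor_rel ?L \<subseteq> tensor_free ?L"
    using im.subspace_add[OF subspace_ad_lattice]
    unfolding g_ad_int_eq[OF l_pos] by (rule tensor_rel_subset_free)
  have com0: "scalar_commuting e 0 0"
    using e' by (auto simp: scalar_commuting_def lin_iff) (metis scale_zero_left)
  have sub: "pm.subspace ?U"
    unfolding U
    using pm.subspace_0[OF subspace_tensor_free] pm.subspace_add[OF subspace_tensor_free]
      pm.subspace_scale[OF subspace_tensor_free] com0
      scalar_commuting_add[OF e'] scalar_commuting_scale[OF e']
    by (intro pm.subspaceI) (auto simp: F.add F.scale F.zero, blast+)
  have "quot_dim pm_scale ?U (tensor_rel ?L) = endo.dim (red_endo ` ?U)"
  proof (rule quot_dim_eq_dim_image[OF linear_red_endo sub])
    show "tensor_rel ?L \<subseteq> ?U"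
      using free red_endo_eq_0_iff com0 unfolding U by fastforce
  qed (use red_endo_eq_0_iff in \<open>simp add: U\<close>)
  also have "red_endo ` ?U = {x \<in> mod_scalar_fixed e. entry x 1 1 = 0}"
  proof
    show "red_endo ` ?U \<subseteq> {x \<in> mod_scalar_fixed e. entry x 1 1 = 0}"
      using similitude_red_endo entry_red_endo[OF one_in one_in]
      by (auto simp: U mod_scalar_fixed_def)
    show "{x \<in> mod_scalar_fixed e. entry x 1 1 = 0} \<subseteq> red_endo ` ?U"
    proof
      fix x assume "x \<in> {x \<in> mod_scalar_fixed e. entry x 1 1 = 0}"
      then obtain c d where x: "similitude c x" "entry x 1 1 = 0" "scalar_commuting e d x"
        by (auto simp: mod_scalar_fixed_def)
      obtain u where "u \<in> tensor_free ?L" "red_endo u = x" using red_endo_surj[OF x(1,2)] .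
      then show "x \<in> red_endo ` ?U" using x(3) unfolding U by blast
    qed
  qed
  finally show ?thesis by (simp add: dim_gad_fixed_def)
qed

end

section \<open>Orthogonal decompositions\<close>

fun block_half :: "block \<Rightarrow> nat" where
  "block_half (Blk_W m) = m"
| "block_half (Blk_Wk k m) = m"
| "block_half (Blk_V d) = d"

fun block_act :: "block \<Rightarrow> (nat \<Rightarrow> 'v::ab_group_add) \<Rightarrow> nat \<Rightarrow> 'v" where
  "block_act (Blk_W m) w i = (if i = 1 \<or> i = m + 1 then 0 else w (i - 1))"
| "block_act (Blk_Wk k m) w i = (if i = 1 \<or> i = m + 1 then 0
     else if i = 2*m - k + 1 then w (2*m - k) + w k else w (i - 1))"
| "block_act (Blk_V d) w i = (if i = 1 then 0 else w (i - 1))"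

fun block_ok :: "block \<Rightarrow> bool" where
  "block_ok (Blk_W m) \<longleftrightarrow> 1 \<le> m"
| "block_ok (Blk_Wk k m) \<longleftrightarrow> 0 < k \<and> 2 * k < m"
| "block_ok (Blk_V d) \<longleftrightarrow> 1 \<le> d"

lemma block_isoE:
  assumes "block_iso scale b e B U"
  obtains w where "block_ok B" "antidiag_basis scale b (block_half B) w U"
    and "\<And>i. i \<in> {1..2 * block_half B} \<Longrightarrow> e (w i) = block_act B w i"
proof (cases B)
  case (Blk_W m)
  then show ?thesis using assms that by auto
next
  case (Blk_Wk k m)
  then obtain w where k: "0 < k" "2 * k < m" and w: "antidiag_basis scale b m w U"
    "e (w 1) = 0" "e (w (m + 1)) = 0" "e (w (2*m - k + 1)) = w (2*m - k) + w k"
    "\<And>i. i\<in>{1..2*m} - {1, m + 1, 2*m - k + 1} \<Longrightarrow> e (w i) = w (i - 1)"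
    using assms by auto
  have "e (w i) = block_act B w i" if "i \<in> {1..2 * block_half B}" for i
    using w k that Blk_Wk by (cases "i = 1"; cases "i = m + 1"; cases "i = 2*m - k + 1") simp_all
  then show ?thesis using that[of w] w(1) k Blk_Wk by simp
next
  case (Blk_V d)
  then show ?thesis using assms that by auto
qed

lemma block_half_pos: "block_ok B \<Longrightarrow> 1 \<le> block_half B"
  by (cases B) auto

definition block_index :: "block list \<Rightarrow> (nat \<times> nat) set" where
  "block_index Bs = (SIGMA p:{..<length Bs}. {1..2 * block_half (Bs ! p)})"

definition block_mirror :: "block list \<Rightarrow> nat \<times> nat \<Rightarrow> nat \<times> nat" where
  "block_mirror Bs q = (fst q, mirror (block_half (Bs ! fst q)) (snd q))"

context char2_symplectic
begin

text \<open>Distinct blocks are orthogonal and each partner index stays in its block, so the block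
  bases form a single paired basis of the whole space. Linear maps can then be defined and tested
  block by block.\<close>

lemma decomposesE:
  assumes "decomposes scale b e Bs"
  obtains w where "\<And>B. B \<in> set Bs \<Longrightarrow> block_ok B"
    and "char2_gram scale b (block_index Bs) (block_mirror Bs) (\<lambda>q. w (fst q) (snd q))"
    and "\<And>p i. (p, i) \<in> block_index Bs \<Longrightarrow> e (w p i) = block_act (Bs ! p) (w p) i"
proof -
  obtain Us where Us: "list_all2 (block_iso scale b e) Bs Us" "orth_direct_sum b Us"
    using assms by (auto simp: decomposes_def)
  have len: "length Us = length Bs" using Us(1) by (simp add: list_all2_lengthD)
  have "\<exists>w. block_ok (Bs ! p) \<and> antidiag_basis scale b (block_half (Bs ! p)) w (Us ! p) \<and>
      (\<forall>i\<in>{1..2 * block_half (Bs ! p)}. e (w i) = block_act (Bs ! p) w i)" if "p < length Bs" for p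
    by (rule block_isoE[OF list_all2_nthD[OF Us(1) that]]) blast
  then obtain w where w: "\<And>p. p < length Bs \<Longrightarrow> block_ok (Bs ! p) \<and>
      antidiag_basis scale b (block_half (Bs ! p)) (w p) (Us ! p) \<and>
      (\<forall>i\<in>{1..2 * block_half (Bs ! p)}. e (w p i) = block_act (Bs ! p) (w p) i)"
    by metis
  let ?w = "\<lambda>q. w (fst q) (snd q)"
  have "char2_gram scale b (block_index Bs) (block_mirror Bs) ?w"
  proof unfold_locales
    show "finite (block_index Bs)" by (simp add: block_index_def)
    fix q assume q: "q \<in> block_index Bs"
    then show "block_mirror Bs q \<in> block_index Bs"
      using mirror_in by (auto simp: block_index_def block_mirror_def mirror_def)
    show "block_mirror Bs (block_mirror Bs q) = q"
      using q by (auto simp: block_index_def block_mirror_def mirror_def)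
    fix r assume r: "r \<in> block_index Bs"
    show "b (?w q) (?w r) = (if r = block_mirror Bs q then 1 else 0)"
    proof (cases "fst q = fst r")
      case True
      then show ?thesis using q r w[of "fst q"]
        by (auto simp: block_index_def block_mirror_def antidiag_basis_def mirror_def split: if_splits)
    next
      case False
      have "w p i \<in> Us ! p" if "p < length Bs" "i \<in> {1..2 * block_half (Bs ! p)}" for p i
      proof -
        have "span (w p ` {1..2 * block_half (Bs ! p)}) = Us ! p"
          using w[OF that(1)] by (simp add: antidiag_basis_def)
        then show ?thesis using that(2) span_base by blast
      qed
      then have "?w q \<in> Us ! fst q" "?w r \<in> Us ! fst r"
        using q r by (auto simp: block_index_def)
      then have "b (?w q) (?w r) = 0"
        using Us(2) False q r len by (auto simp: orth_direct_sum_def block_index_def)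
      then show ?thesis using False by (auto simp: block_mirror_def)
    qed
  next
    have "x \<in> span (?w ` block_index Bs)" for x
    proof -
      obtain us where us: "length us = length Us" "\<forall>p<length Us. us ! p \<in> Us ! p" "sum_list us = x"
        using Us(2) unfolding orth_direct_sum_def by metis
      have "us ! p \<in> span (?w ` block_index Bs)" if p: "p < length Us" for p
      proof -
        have "us ! p \<in> span (w p ` {1..2 * block_half (Bs ! p)})"
          using us(2) p w[of p] len by (simp add: antidiag_basis_def)
        moreover have "w p ` {1..2 * block_half (Bs ! p)} \<subseteq> ?w ` block_index Bs"
          using p len by (force simp: block_index_def)
        ultimately show ?thesis using span_mono by blast
      qed
      then have "(\<Sum>p<length Us. us ! p) \<in> span (?w ` block_index Bs)"
        by (intro span_sum) auto
      then show ?thesis using us(1,3) by (simp add: sum_list_sum_nth atLeast0LessThan)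
    qed
    then show "span (?w ` block_index Bs) = UNIV" by blast
  qed
  moreover have "block_ok B" if "B \<in> set Bs" for B
    using that w by (metis in_set_conv_nth)
  moreover have "e (w p i) = block_act (Bs ! p) (w p) i" if "(p, i) \<in> block_index Bs" for p i
    using that w[of p] by (auto simp: block_index_def)
  ultimately show ?thesis using that by blast
qed

section \<open>Similitudes built on the blocks\<close>

text \<open>The halves \<open>i \<le> m\<close> and \<open>i > m\<close> of \<open>W(m)\<close> are
  \<open>e\<close>-invariant and exchanged by the mirror. So of each dual pair of basis vectors
  exactly one survives the projection, which gives multiplier 1.\<close>

lemma W_form_imp_similitude:
  assumes e: "lin e" and D: "decomposes scale b e (map Blk_W ms)"
  shows "\<exists>x. similitude 1 x \<and> scalar_commuting e 0 x"
proof -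
  let ?Bs = "map Blk_W ms"
  obtain w where ok: "\<And>B. B \<in> set ?Bs \<Longrightarrow> block_ok B"
    and g: "char2_gram scale b (block_index ?Bs) (block_mirror ?Bs) (\<lambda>q. w (fst q) (snd q))"
    and act: "\<And>p i. (p, i) \<in> block_index ?Bs \<Longrightarrow> e (w p i) = block_act (?Bs ! p) (w p) i"
    using decomposesE[OF D] by blast
  interpret g: char2_gram scale b "block_index ?Bs" "block_mirror ?Bs" "\<lambda>q. w (fst q) (snd q)" by (rule g)
  define x where "x = g.ext (\<lambda>q. if snd q \<le> ms ! fst q then w (fst q) (snd q) else 0)"
  have x: "x (w p i) = (if i \<le> ms ! p then w p i else 0)" if "(p, i) \<in> block_index ?Bs" for p i
    using g.ext_v[OF that] by (simp add: x_def)
  have lx: "lin x" unfolding x_def by (rule g.lin_ext)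
  have z: "e 0 = 0" "x 0 = 0" using lin_sum[OF e, of id "{}"] lin_sum[OF lx, of id "{}"] by auto
  have "similitude 1 x"
  proof (rule g.similitudeI[OF lx])
    fix q r assume qr: "q \<in> block_index ?Bs" "r \<in> block_index ?Bs"
    obtain p i p' j where [simp]: "q = (p, i)" "r = (p', j)" by fastforce
    have "i \<le> ms ! p \<longleftrightarrow> \<not> j \<le> ms ! p'" if "r = block_mirror ?Bs q"
      using that qr by (auto simp: block_mirror_def block_index_def mirror_def)
    then show "b (x (w (fst q) (snd q))) (w (fst r) (snd r)) + b (w (fst q) (snd q)) (x (w (fst r) (snd r))) =
        1 * b (w (fst q) (snd q)) (w (fst r) (snd r))"
      using g.gram[OF qr] qr by (auto simp: x)
  qed
  moreover have "scalar_commuting e 0 x"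
  proof (rule g.scalar_commutingI[OF e lx])
    fix q assume q: "q \<in> block_index ?Bs"
    obtain p i where [simp]: "q = (p, i)" by fastforce
    have "(p, i - 1) \<in> block_index ?Bs" if "i \<noteq> 1" using q that by (auto simp: block_index_def)
    then show "e (x (w (fst q) (snd q))) - x (e (w (fst q) (snd q))) = 0 *s w (fst q) (snd q)"
      using q x[of p i] x[of p "i - 1"] act[of p i] z
      by (auto simp: block_index_def split: if_splits)
  qed
  ultimately show ?thesis by blast
qed

text \<open>On \<open>W(m)\<close> and \<open>V(2d)\<close> the operator \<open>w\<^sub>i \<mapsto> i w\<^bsub>i+1\<^esub>\<close> has commutator \<open>1\<close> with \<open>e\<close>. On \<open>W\<^sub>k(m)\<close> the extra
  term \<open>w\<^sub>k\<close> in \<open>e w\<^bsub>2m-k+1\<^esub>\<close> spoils this by \<open>k\<close> times \<open>w\<^bsub>2m-k\<^esub> \<mapsto> w\<^sub>k\<close>, \<open>w\<^bsub>2m-k+1\<^esub> \<mapsto> w\<^bsub>k+1\<^esub>\<close>, which is the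
  commutator of \<open>e\<close> with \<open>k\<close> times \<open>w\<^bsub>2m-k\<^esub> \<mapsto> w\<^bsub>k+1\<^esub>\<close>. For \<open>i = 2m\<close> the vector \<open>w\<^bsub>i+1\<^esub>\<close> is
  arbitrary, but its coefficient vanishes.\<close>

fun raise_act :: "block \<Rightarrow> (nat \<Rightarrow> 'v) \<Rightarrow> nat \<Rightarrow> 'v" where
  "raise_act (Blk_Wk k m) w i = of_nat i *s w (i + 1) + (if i = 2*m - k then of_nat k *s w (k + 1) else 0)"
| "raise_act B w i = of_nat i *s w (i + 1)"

lemma of_nat_even: "even n \<Longrightarrow> of_nat n = (0::'k)"
  using char_two by (auto elim!: evenE)

text \<open>Here \<open>e x\<close> and \<open>x e\<close> multiply \<open>w i\<close> by
  \<open>i\<close> and \<open>i - 1\<close>. In \<open>W(m)\<close> and \<open>Wk\<close> the chain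
  breaks between \<open>m\<close> and \<open>m + 1\<close>; an even \<open>m\<close> makes the
  missing coefficient zero. At the top end the coefficient is the even number
  \<open>2 * block_half B\<close>.\<close>

lemma raise_act_commutes:
  assumes e: "lin e" and x: "lin x" and ok: "block_ok B" and ev: "even (block_half B) \<or> (\<exists>d. B = Blk_V d)"
    and act: "\<And>i. i \<in> {1..2 * block_half B} \<Longrightarrow> e (w i) = block_act B w i"
    and raise: "\<And>i. i \<in> {1..2 * block_half B} \<Longrightarrow> x (w i) = raise_act B w i"
    and i: "i \<in> {1..2 * block_half B}"
  shows "e (x (w i)) - x (e (w i)) = w i"
proof -
  have el: "e (u + y) = e u + e y" "e (c *s u) = c *s e u" "e 0 = 0"
    and xl: "x (u + y) = x u + x y" "x (c *s u) = c *s x u" "x 0 = 0" for u y c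
    using e x lin_sum[OF e, of id "{}"] lin_sum[OF x, of id "{}"] by (auto simp: lin_iff)
  let ?m = "block_half B"
  have c1: "e (x (w i)) = of_nat i *s w i"
  proof (cases "even i \<and> (\<forall>k m. B \<noteq> Blk_Wk k m)")
    case True
    then have "x (w i) = 0" using raise[OF i] by (cases B) (auto simp: of_nat_even)
    then show ?thesis using True by (simp add: el of_nat_even)
  next
    case False
    show ?thesis
    proof (cases B)
      case (Blk_Wk k m)
      then have k: "0 < k" "2 * k < m" "even m" using ok ev by auto
      have ek: "e (w (k + 1)) = w k" using act[of "k + 1"] k Blk_Wk by auto
      show ?thesis
      proof (cases "i = 2*m - k")
        case True
        have "e (w (i + 1)) = w i + w k" using act[of "i + 1"] k Blk_Wk True by auto
        \<comment> \<open>The unwanted multiples of \<open>w k\<close>, one from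
          \<open>e (w (i + 1))\<close> and one from the correction term, add up to
          \<open>i + k = 2 m\<close> copies.\<close>
        moreover have "of_nat i + of_nat k = (0::'k)"
          using True k of_nat_even[of "i + k"] by simp
        ultimately show ?thesis using raise[OF i] True Blk_Wk ek
          by (simp add: el scale_right_distrib add.assoc flip: scale_left_distrib)
      next
        case False
        have r: "x (w i) = of_nat i *s w (i + 1)" using raise[OF i] Blk_Wk False by simp
        show ?thesis
        proof (cases "even i")
          case True
          then show ?thesis using r by (simp add: of_nat_even el)
        next
          case odd: False
          have "e (w (i + 1)) = w i"
            using act[of "i + 1"] k Blk_Wk False odd i by (cases "i = 2*m") auto
          then show ?thesis using r by (simp add: el)
        qed
      qed
    next
      case (Blk_W m)
      then have "e (w (i + 1)) = w i"
        using act[of "i + 1"] False ev i by (cases "i = 2*m") auto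
      then show ?thesis using raise[OF i] Blk_W by (simp add: el)
    next
      case (Blk_V d)
      then have "e (w (i + 1)) = w i"
        using act[of "i + 1"] False i by (cases "i = 2*d") auto
      then show ?thesis using raise[OF i] Blk_V by (simp add: el)
    qed
  qed
  have im: "i - 1 \<in> {1..2 * block_half B}" if "i \<noteq> 1" using that i by auto
  have c2: "x (e (w i)) = of_nat (i - 1) *s w i"
  proof (cases B)
    case (Blk_W m)
    then have "x (e (w i)) = 0 \<and> even (i - 1) \<or> x (e (w i)) = of_nat (i - 1) *s w i"
      using act[OF i] raise[OF im] i ev xl(3) by (cases "i = 1 \<or> i = m + 1") auto
    then show ?thesis by (auto simp: of_nat_even)
  next
    case (Blk_V d)
    then show ?thesis using act[OF i] raise[OF im] i xl(3) by (cases "i = 1") auto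
  next
    case (Blk_Wk k m)
    then have k: "0 < k" "2 * k < m" "even m" using ok ev by auto
    consider "i = 1 \<or> i = m + 1" | "i = 2*m - k + 1" | "i \<noteq> 1" "i \<noteq> m + 1" "i \<noteq> 2*m - k + 1" by blast
    then show ?thesis
    proof cases
      case 1
      then have "x (e (w i)) = 0" "even (i - 1)" using act[OF i] k Blk_Wk xl(3) by auto
      then show ?thesis by (simp add: of_nat_even)
    next
      case 2
      \<comment> \<open>The correction term equals the image of \<open>w k\<close>, so the two
        cancel when \<open>x\<close> is applied to \<open>w (2*m - k) + w k\<close>.\<close>
      have "x (w (2*m - k)) = of_nat (2*m - k) *s w (2*m - k + 1) + of_nat k *s w (k + 1)"
        "x (w k) = of_nat k *s w (k + 1)"
        using raise[of "2*m - k"] raise[of k] k Blk_Wk by auto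
      moreover have "e (w i) = w (2*m - k) + w k" using act[OF i] 2 k Blk_Wk by auto
      ultimately show ?thesis using 2 by (simp add: xl add.assoc flip: scale_left_distrib)
    next
      case 3
      then have "e (w i) = w (i - 1)" "i - 1 \<noteq> 2*m - k" "i - 1 \<in> {1..2 * block_half B}"
        using act[OF i] i k Blk_Wk by auto
      then show ?thesis using raise[of "i - 1"] Blk_Wk 3 i by auto
    qed
  qed
  have "of_nat i = of_nat (i - 1) + (1::'k)" using i by (cases i) auto
  then show ?thesis unfolding c1 c2 by (simp add: scale_left_distrib)
qed

text \<open>The main terms contribute \<open>i + j\<close>, and only when this equals
  \<open>2 * block_half B\<close>, which is even. The correction on \<open>Wk\<close> is nonzero
  only for \<open>i = j = 2*m - k\<close>, where it occurs twice.\<close>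

lemma raise_act_pairing:
  assumes gram: "\<And>i j. i \<in> {1..2 * block_half B} \<Longrightarrow> j \<in> {1..2 * block_half B} \<Longrightarrow>
      b (w i) (w j) = (if i + j = 2 * block_half B + 1 then 1 else 0)"
    and ok: "block_ok B"
    and i: "i \<in> {1..2 * block_half B}" and j: "j \<in> {1..2 * block_half B}"
  shows "b (raise_act B w i) (w j) + b (w i) (raise_act B w j) = 0"
proof -
  let ?m = "block_half B"
  have main: "b (of_nat i *s w (i + 1)) (w j) = (if i + j = 2 * ?m then of_nat i else 0)"
    if "i \<in> {1..2 * ?m}" "j \<in> {1..2 * ?m}" for i j
  proof (cases "i = 2 * ?m")
    case True
    then show ?thesis using that of_nat_even[of i] by simp
  next
    case False
    then show ?thesis using gram[of "i + 1" j] that by auto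
  qed
  have corr: "b (w (k + 1)) (w j) = (if j = 2*m - k then 1 else 0)"
    if "B = Blk_Wk k m" "j \<in> {1..2 * ?m}" for k m j
    using gram[of "k + 1" j] that ok by auto
  have p: "b (raise_act B w i) (w j) = (if i + j = 2 * ?m then of_nat i else 0) +
      (case B of Blk_Wk k m \<Rightarrow> if i = 2*m - k \<and> j = 2*m - k then of_nat k else 0 | _ \<Rightarrow> 0)"
    if "i \<in> {1..2 * ?m}" "j \<in> {1..2 * ?m}" for i j
    using main[OF that] corr[OF _ that(2)] by (cases B) (auto simp del: of_nat_add of_nat_mult)
  have "(if i + j = 2 * ?m then of_nat i else 0) + (if j + i = 2 * ?m then of_nat j else (0::'k)) = 0"
  proof (cases "i + j = 2 * ?m")
    case True
    then have "even (i + j)" by simp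
    then have "of_nat i + of_nat j = (0::'k)" using of_nat_even unfolding of_nat_add[symmetric] by blast
    then show ?thesis using True by (simp add: add.commute)
  qed (simp add: add.commute)
  then show ?thesis
    unfolding b_commute[of "w i"] p[OF i j] p[OF j i]
    by (cases B) (auto simp: algebra_simps split: if_splits)
qed

lemma all_even_imp_similitude:
  assumes e: "lin e" and D: "decomposes scale b e Bs"
    and ev: "\<And>B. B \<in> set Bs \<Longrightarrow> even (block_half B) \<or> (\<exists>d. B = Blk_V d)"
  shows "\<exists>x. similitude 0 x \<and> scalar_commuting e 1 x"
proof -
  obtain w where ok: "\<And>B. B \<in> set Bs \<Longrightarrow> block_ok B"
    and g: "char2_gram scale b (block_index Bs) (block_mirror Bs) (\<lambda>q. w (fst q) (snd q))"
    and act: "\<And>p i. (p, i) \<in> block_index Bs \<Longrightarrow> e (w p i) = block_act (Bs ! p) (w p) i"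
    using decomposesE[OF D] by blast
  interpret g: char2_gram scale b "block_index Bs" "block_mirror Bs" "\<lambda>q. w (fst q) (snd q)" by (rule g)
  define x where "x = g.ext (\<lambda>q. raise_act (Bs ! fst q) (w (fst q)) (snd q))"
  have x: "x (w p i) = raise_act (Bs ! p) (w p) i" if "(p, i) \<in> block_index Bs" for p i
    using g.ext_v[OF that] by (simp add: x_def)
  have lx: "lin x" unfolding x_def by (rule g.lin_ext)
  have idx: "(p, i) \<in> block_index Bs \<longleftrightarrow> p < length Bs \<and> i \<in> {1..2 * block_half (Bs ! p)}" for p i
    by (auto simp: block_index_def)
  have gram: "b (w p i) (w p' j) = (if p = p' \<and> i + j = 2 * block_half (Bs ! p) + 1 then 1 else 0)"
    if "(p, i) \<in> block_index Bs" "(p', j) \<in> block_index Bs" for p i p' j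
    using g.gram[OF that] that by (auto simp: block_mirror_def mirror_def block_index_def)
  have cross: "b (raise_act (Bs ! p) (w p) i) (w p' j) = 0"
    if "(p, i) \<in> block_index Bs" "(p', j) \<in> block_index Bs" "p \<noteq> p'" for p i p' j
  proof -
    \<comment> \<open>The raising operator could leave its block only from the last vector, where
      the coefficient is even.\<close>
    have "b (of_nat i *s w p (i + 1)) (w p' j) = 0"
    proof (cases "i = 2 * block_half (Bs ! p)")
      case True
      then show ?thesis using of_nat_even[of i] by simp
    next
      case False
      then have "(p, i + 1) \<in> block_index Bs" using that(1) unfolding idx by auto
      from gram[OF this that(2)] show ?thesis using that(3) by simp
    qed
    moreover have "b (w p (k + 1)) (w p' j) = 0" if "Bs ! p = Blk_Wk k m" for k m
    proof -
      have "block_ok (Blk_Wk k m)" using ok that \<open>(p, i) \<in> _\<close> unfolding idx by (metis nth_mem)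
      then have "(p, k + 1) \<in> block_index Bs" using that \<open>(p, i) \<in> _\<close> unfolding idx by auto
      from gram[OF this \<open>(p', j) \<in> _\<close>] show ?thesis using \<open>p \<noteq> p'\<close> by simp
    qed
    ultimately show ?thesis by (cases "Bs ! p") auto
  qed
  have "similitude 0 x"
  proof (rule g.similitudeI[OF lx])
    fix q r assume qr: "q \<in> block_index Bs" "r \<in> block_index Bs"
    obtain p i p' j where [simp]: "q = (p, i)" "r = (p', j)" by fastforce
    have "b (x (w p i)) (w p' j) + b (w p i) (x (w p' j)) = 0"
    proof (cases "p = p'")
      case True
      have "block_ok (Bs ! p)" using qr ok unfolding \<open>q = _\<close> idx by (metis nth_mem)
      then show ?thesis
        using raise_act_pairing[of "Bs ! p" "w p" i j] gram qr True x by (auto simp: idx)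
    next
      case False
      then show ?thesis using cross[of p i p' j] cross[of p' j p i] qr x b_commute by auto
    qed
    then show "b (x (w (fst q) (snd q))) (w (fst r) (snd r)) + b (w (fst q) (snd q)) (x (w (fst r) (snd r))) =
        0 * b (w (fst q) (snd q)) (w (fst r) (snd r))" by simp
  qed
  moreover have "scalar_commuting e 1 x"
  proof (rule g.scalar_commutingI[OF e lx])
    fix q assume q: "q \<in> block_index Bs"
    obtain p i where [simp]: "q = (p, i)" by fastforce
    have p: "p < length Bs" "i \<in> {1..2 * block_half (Bs ! p)}" using q idx by auto
    have "e (x (w p i)) - x (e (w p i)) = w p i"
      by (rule raise_act_commutes[OF e lx ok ev _ _ p(2)]) (use p act x idx in auto)
    then show "e (x (w (fst q) (snd q))) - x (e (w (fst q) (snd q))) = 1 *s w (fst q) (snd q)"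
      by simp
  qed
  ultimately show ?thesis by blast
qed

end

section \<open>Obstructions from powers of \<open>e\<close>\<close>

lemma funpow_chain:
  assumes "\<And>i. a < i \<Longrightarrow> i \<le> c \<Longrightarrow> e (w i) = w (i - 1)" and "j \<le> c - a" and "a \<le> (c::nat)"
  shows "(e ^^ j) (w c) = w (c - j)"
  using assms(2)
proof (induction j)
  case (Suc j)
  then have "(e ^^ j) (w c) = w (c - j)" "a < c - j" by auto
  then show ?case using assms(1)[of "c - j"] by simp
qed simp

lemma funpow_pred: "0 < n \<Longrightarrow> (e ^^ n) u = e ((e ^^ (n - 1)) u)"
  by (cases n) auto

context char2_symplectic
begin

lemma adjoint: "similitude 0 e \<Longrightarrow> b (e u) w = b u (e w)"
  unfolding similitude_def using char_two_diff[OF char_two] by (metis char2(2) eq_neg_iff_add_eq_0 mult_zero_left)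

lemma adjoint_funpow:
  assumes "similitude 0 e"
  shows "b ((e ^^ j) u) w = b u ((e ^^ j) w)"
proof (induction j arbitrary: u)
  case (Suc j)
  have "b ((e ^^ Suc j) u) w = b ((e ^^ j) (e u)) w" by (simp add: funpow_swap1)
  also have "\<dots> = b u ((e ^^ Suc j) w)" using Suc adjoint[OF assms] by simp
  finally show ?case .
qed simp

lemma lin_funpow: "lin e \<Longrightarrow> lin (e ^^ j)"
  by (induction j) (auto simp: lin_iff)

text \<open>Evaluate the multiplier identity at \<open>(e ^^ j) w\<close> and \<open>w\<close>. As
  \<open>e ^^ j\<close> is self-adjoint and commutes with \<open>x\<close>, both terms on the left
  equal \<open>b (x w) ((e ^^ j) w)\<close> and cancel.\<close>

lemma similitude_commuting_imp_form_zero: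
  assumes e: "similitude 0 e" and x: "similitude c x" and c: "c \<noteq> 0" and com: "scalar_commuting e 0 x"
  shows "b ((e ^^ j) w) w = 0"
proof -
  have 1: "e (x u) = x (e u)" for u using com by (simp add: scalar_commuting_def)
  have j: "(e ^^ j) (x u) = x ((e ^^ j) u)" for u
    by (induction j) (simp_all add: 1)
  have "c * b ((e ^^ j) w) w = b (x ((e ^^ j) w)) w + b ((e ^^ j) w) (x w)"
    using x by (simp add: similitude_def)
  also have "\<dots> = b (x w) ((e ^^ j) w) + b (x w) ((e ^^ j) w)"
    unfolding j[symmetric] using adjoint_funpow[OF e] b_commute by metis
  also have "\<dots> = 0" by simp
  finally show ?thesis using c by simp
qed

lemma scalar_commuting_funpow:
  assumes e: "lin e" and x: "lin x" and com: "scalar_commuting e d x"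
  shows "(e ^^ Suc n) (x u) = x ((e ^^ Suc n) u) + (of_nat (Suc n) * d) *s (e ^^ n) u"
proof -
  have 1: "e (x u) = x (e u) + d *s u" for u
    using com by (simp add: scalar_commuting_def algebra_simps eq_diff_eq[symmetric])
  have el: "e (u + y) = e u + e y" "e (c *s u) = c *s e u" for u y c
    using e by (auto simp: lin_iff)
  show ?thesis
  proof (induction n)
    case 0
    then show ?case by (simp add: 1)
  next
    case (Suc n)
    have "(e ^^ Suc (Suc n)) (x u) = e ((e ^^ Suc n) (x u))" by simp
    also have "\<dots> = e (x ((e ^^ Suc n) u)) + (of_nat (Suc n) * d) *s (e ^^ Suc n) u"
      unfolding Suc by (simp add: el)
    also have "\<dots> = x ((e ^^ Suc (Suc n)) u) + (d *s (e ^^ Suc n) u + (of_nat (Suc n) * d) *s (e ^^ Suc n) u)"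
      by (simp add: 1 add.assoc)
    also have "d *s (e ^^ Suc n) u + (of_nat (Suc n) * d) *s (e ^^ Suc n) u
        = (of_nat (Suc (Suc n)) * d) *s (e ^^ Suc n) u"
      unfolding scale_left_distrib[symmetric] of_nat_Suc[of "Suc n"] by (simp only: distrib_right mult_1_left)
    finally show ?case .
  qed
qed

text \<open>The path from the top vector branches after \<open>k\<close> steps into
  \<open>w (2*m - k)\<close> and \<open>w k\<close>. After \<open>k - 1\<close> more steps the lower
  branch has reached its end \<open>w 1\<close>. The upper branch needs \<open>m - k\<close> steps
  from the branching point to die, \<open>m\<close> in all, and by then the shorter lower branch is
  gone too.\<close>

lemma Wk_top:
  assumes e: "lin e" and k: "0 < k" "2 * k < m"
    and act: "\<And>i. i \<in> {1..2*m} \<Longrightarrow> e (w i) = block_act (Blk_Wk k m) w i"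
  shows "(e ^^ (2*k - 1)) (w (2*m)) = w (2*m - 2*k + 1) + w 1"
    and "(e ^^ m) (w (2*m)) = 0"
proof -
  have add: "(e ^^ j) (u + y) = (e ^^ j) u + (e ^^ j) y" and zero: "(e ^^ j) 0 = 0" for j u y
    using lin_funpow[OF e] lin_sum[OF lin_funpow[OF e], of j id "{}"] by (auto simp: lin_iff)
  have a1: "(e ^^ (k - 1)) (w (2*m)) = w (2*m - k + 1)"
  proof -
    have "(e ^^ (k - 1)) (w (2*m)) = w (2*m - (k - 1))"
    proof (rule funpow_chain[of "2*m - k + 1"])
      fix i assume "2*m - k + 1 < i" "i \<le> 2*m"
      moreover from this have "i \<noteq> 1" "i \<noteq> m + 1" "i \<noteq> 2*m - k + 1" using k by linarith+
      ultimately show "e (w i) = w (i - 1)" using act[of i] by simp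
    qed (use k in auto)
    moreover have "2*m - (k - 1) = 2*m - k + 1" using k by simp
    ultimately show ?thesis by (simp only:)
  qed
  have a2: "(e ^^ k) (w (2*m)) = w (2*m - k) + w k"
  proof -
    have "2*m - k + 1 \<in> {1..2*m}" "2*m - k + 1 \<noteq> 1" "2*m - k + 1 \<noteq> m + 1" using k by auto
    then have "e (w (2*m - k + 1)) = w (2*m - k) + w k" using act[of "2*m - k + 1"] by simp
    then show ?thesis using a1 k funpow_pred[of k e] by simp
  qed
  have b1: "(e ^^ j) (w (2*m - k)) = w (2*m - k - j)" if "j \<le> m - k - 1" for j
  proof (rule funpow_chain[of "m + 1"])
    fix i assume "m + 1 < i" "i \<le> 2*m - k"
    moreover from this have "i \<noteq> 1" "i \<noteq> 2*m - k + 1" "i \<le> 2*m" using k by linarith+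
    ultimately show "e (w i) = w (i - 1)" using act[of i] by simp
  qed (use k that in auto)
  have b2: "(e ^^ j) (w k) = w (k - j)" if "j \<le> k - 1" for j
  proof (rule funpow_chain[of 1])
    fix i assume "1 < i" "i \<le> k"
    moreover from this have "i \<noteq> m + 1" "i \<noteq> 2*m - k + 1" "i \<le> 2*m" using k by linarith+
    ultimately show "e (w i) = w (i - 1)" using act[of i] by simp
  qed (use k that in auto)
  have "2*k - 1 = (k - 1) + k" using k by simp
  then have "(e ^^ (2*k - 1)) (w (2*m)) = (e ^^ (k - 1)) (w (2*m - k)) + (e ^^ (k - 1)) (w k)"
    by (simp add: funpow_add a2 add)
  also have "\<dots> = w (2*m - k - (k - 1)) + w (k - (k - 1))"
    using b1[of "k - 1"] b2[of "k - 1"] k by simp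
  also have "2*m - k - (k - 1) = 2*m - 2*k + 1" using k by simp
  also have "k - (k - 1) = 1" using k by simp
  finally show "(e ^^ (2*k - 1)) (w (2*m)) = w (2*m - 2*k + 1) + w 1" .
  have "(e ^^ (m - k)) (w (2*m - k)) = e ((e ^^ (m - k - 1)) (w (2*m - k)))"
    using k funpow_pred[of "m - k" e] by simp
  also have "\<dots> = 0" using b1[of "m - k - 1"] act[of "m + 1"] k by simp
  finally have c1: "(e ^^ (m - k)) (w (2*m - k)) = 0" .
  have "(e ^^ k) (w k) = e ((e ^^ (k - 1)) (w k))"
    using k funpow_pred[of k e] by simp
  also have "\<dots> = 0" using b2[of "k - 1"] act[of 1] k by simp
  finally have c2: "(e ^^ k) (w k) = 0" .
  have "m - k = (m - 2*k) + k" using k by simp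
  then have "(e ^^ (m - k)) (w k) = (e ^^ (m - 2*k)) ((e ^^ k) (w k))" by (metis funpow_add comp_apply)
  then have c3: "(e ^^ (m - k)) (w k) = 0" by (simp only: c2 zero)
  have "m = (m - k) + k" using k by simp
  then have "(e ^^ m) (w (2*m)) = (e ^^ (m - k)) ((e ^^ k) (w (2*m)))" by (metis funpow_add comp_apply)
  then show "(e ^^ m) (w (2*m)) = 0" by (simp add: a2 add c1 c3)
qed

lemma similitude_imp_W:
  assumes e: "similitude 0 e" and D: "decomposes scale b e Bs"
    and x: "similitude c x" "c \<noteq> 0" "scalar_commuting e 0 x" and B: "B \<in> set Bs"
  shows "\<exists>m. B = Blk_W m"
proof (rule ccontr)
  assume nW: "\<nexists>m. B = Blk_W m"
  obtain w' where ok: "\<And>B. B \<in> set Bs \<Longrightarrow> block_ok B"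
    and g: "char2_gram scale b (block_index Bs) (block_mirror Bs) (\<lambda>q. w' (fst q) (snd q))"
    and act': "\<And>p i. (p, i) \<in> block_index Bs \<Longrightarrow> e (w' p i) = block_act (Bs ! p) (w' p) i"
    using decomposesE[OF D] by blast
  interpret g: char2_gram scale b "block_index Bs" "block_mirror Bs" "\<lambda>q. w' (fst q) (snd q)" by (rule g)
  have le: "lin e" using e by (simp add: similitude_def)
  note zero = similitude_commuting_imp_form_zero[OF e x]
  obtain p where p: "p < length Bs" "Bs ! p = B" using B by (metis in_set_conv_nth)
  define w where "w = w' p"
  have idx: "(p, i) \<in> block_index Bs" if "i \<in> {1..2 * block_half B}" for i
    using that p by (auto simp: block_index_def)
  have gram: "b (w i) (w j) = (if i + j = 2 * block_half B + 1 then 1 else 0)"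
    if "i \<in> {1..2 * block_half B}" "j \<in> {1..2 * block_half B}" for i j
    using g.gram[OF idx[OF that(1)] idx[OF that(2)]] that p
    by (auto simp: w_def block_mirror_def mirror_def split: if_splits)
  have act: "e (w i) = block_act B w i" if "i \<in> {1..2 * block_half B}" for i
    using act'[OF idx[OF that]] p by (simp add: w_def)
  show False
  proof (cases B)
    case (Blk_W m)
    then show ?thesis using nW by simp
  next
    case (Blk_V d)
    then have d: "1 \<le> d" using ok[OF B] by simp
    have "(e ^^ (2*d - 1)) (w (2*d)) = w 1"
      using funpow_chain[of 1 "2*d" e w "2*d - 1"] act d Blk_V by auto
    then show False using zero[of "2*d - 1" "w (2*d)"] gram[of 1 "2*d"] d Blk_V by simp
  next
    case (Blk_Wk k m)
    then have k: "0 < k" "2 * k < m" using ok[OF B] by auto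
    have "(e ^^ (2*k - 1)) (w (2*m)) = w (2*m - 2*k + 1) + w 1"
      by (rule Wk_top(1)[OF le k]) (use act Blk_Wk in auto)
    \<comment> \<open>The partner of \<open>w (2*m)\<close> is \<open>w 1\<close>, so the upper
      branch does not contribute: \<open>2 * k < m\<close> keeps its index above
      \<open>m + 1\<close>.\<close>
    moreover have "b (w (2*m - 2*k + 1)) (w (2*m)) = 0"
      by (subst gram) (use k Blk_Wk in auto)
    moreover have "b (w 1) (w (2*m)) = 1"
      by (subst gram) (use k Blk_Wk in auto)
    ultimately show False
      using zero[of "2*k - 1" "w (2*m)"] by simp
  qed
qed

text \<open>Outside \<open>V(2d)\<close>, \<open>e ^^ m\<close> kills both \<open>w m\<close> and
  \<open>w (2*m)\<close>, while \<open>e ^^ (m - 1)\<close> sends \<open>w m\<close> to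
  \<open>w 1\<close>, the partner of \<open>w (2*m)\<close>. Pairing
  \<open>[e^m, x] (w m) = m d (w 1)\<close> with \<open>w (2*m)\<close> and moving
  \<open>e ^^ m\<close> to the other side yields \<open>m d = 0\<close>.\<close>

lemma scalar_commuting_imp_even:
  assumes e: "similitude 0 e" and D: "decomposes scale b e Bs"
    and x: "lin x" "d \<noteq> 0" "scalar_commuting e d x" and B: "B \<in> set Bs" "\<nexists>d. B = Blk_V d"
  shows "even (block_half B)"
proof -
  obtain w' where ok: "\<And>B. B \<in> set Bs \<Longrightarrow> block_ok B"
    and g: "char2_gram scale b (block_index Bs) (block_mirror Bs) (\<lambda>q. w' (fst q) (snd q))"
    and act': "\<And>p i. (p, i) \<in> block_index Bs \<Longrightarrow> e (w' p i) = block_act (Bs ! p) (w' p) i"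
    using decomposesE[OF D] by blast
  interpret g: char2_gram scale b "block_index Bs" "block_mirror Bs" "\<lambda>q. w' (fst q) (snd q)" by (rule g)
  have le: "lin e" using e by (simp add: similitude_def)
  obtain p where p: "p < length Bs" "Bs ! p = B" using B by (metis in_set_conv_nth)
  define w where "w = w' p"
  define m where "m = block_half B"
  have m1: "1 \<le> m" using block_half_pos[OF ok[OF B(1)]] by (simp add: m_def)
  have idx: "(p, i) \<in> block_index Bs" if "i \<in> {1..2 * m}" for i
    using that p by (auto simp: block_index_def m_def)
  have gram: "b (w 1) (w (2*m)) = 1"
    using g.gram[OF idx[of 1] idx[of "2*m"]] p m1
    by (auto simp: w_def block_mirror_def mirror_def m_def)
  have act: "e (w i) = block_act B w i" if "i \<in> {1..2 * m}" for i
    using act'[OF idx[OF that]] p by (simp add: w_def)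
  have low: "e (w i) = w (i - 1)" if "1 < i" "i \<le> m" for i
    using act[of i] that B(2) ok[OF B(1)] by (cases B) (auto simp: m_def)
  have bot: "(e ^^ (m - 1)) (w m) = w 1"
    using funpow_chain[of 1 m e w "m - 1"] low m1 by simp
  have e1: "e (w 1) = 0" using act[of 1] m1 by (cases B) auto
  have em: "(e ^^ m) (w m) = 0"
    using bot e1 funpow_pred[of m e] m1 by simp
  have top: "(e ^^ m) (w (2*m)) = 0"
  proof (cases B)
    case (Blk_W m')
    then have [simp]: "m' = m" by (simp add: m_def)
    have "(e ^^ (m - 1)) (w (2*m)) = w (m + 1)"
      using funpow_chain[of "m + 1" "2*m" e w "m - 1"] act Blk_W m1 by auto
    then show ?thesis
      using act[of "m + 1"] Blk_W funpow_pred[of m e] m1 by simp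
  next
    case (Blk_Wk k m')
    then have [simp]: "m' = m" by (simp add: m_def)
    show ?thesis by (rule Wk_top(2)[OF le]) (use Blk_Wk ok[OF B(1)] act in auto)
  next
    case (Blk_V d)
    then show ?thesis using B(2) by simp
  qed
  have "(e ^^ m) (x (w m)) = x ((e ^^ m) (w m)) + (of_nat m * d) *s (e ^^ (m - 1)) (w m)"
    using scalar_commuting_funpow[OF le x(1,3), of "m - 1" "w m"] m1 by simp
  also have "\<dots> = (of_nat m * d) *s w 1"
    using lin_sum[OF x(1), of id "{}"] by (simp add: em bot del: One_nat_def)
  finally have "b ((e ^^ m) (x (w m))) (w (2*m)) = of_nat m * d" using gram by simp
  moreover have "b ((e ^^ m) (x (w m))) (w (2*m)) = 0"
    using adjoint_funpow[OF e, of m "x (w m)" "w (2*m)"] top by simp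
  ultimately have "of_nat m = (0::'k)" using x(2) by simp
  then show ?thesis using char_two by (simp add: of_nat_eq_0_iff_char_dvd m_def)
qed

lemma decomposes_Nil: "decomposes scale b e [] \<Longrightarrow> (x :: 'v) = 0"
  by (auto simp: decomposes_def orth_direct_sum_def)

end

section \<open>The dimension formula\<close>

theorem corollary1p7:
  fixes scale :: "'k::alg_closed_field \<Rightarrow> 'v::ab_group_add \<Rightarrow> 'v"
    and b :: "'v \<Rightarrow> 'v \<Rightarrow> 'k"
    and l :: nat
    and v :: "nat \<Rightarrow> 'v"
    and e :: "'v \<Rightarrow> 'v"
    and ms ds :: "nat list"
    and kls :: "(nat \<times> nat) list"
    and \<alpha> :: nat
  assumes char_two: "CHAR('k) = 2"
    and vs: "vector_space scale"
    and l_pos: "l \<ge> 1"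
    and dim_V: "vector_space.dim scale (UNIV :: 'v set) = 2 * l"
    and form: "nondeg_alternating scale b"
    and basis: "antidiag_basis scale b l v UNIV"
    and e_sp: "e \<in> sp scale b"
    and e_nilp: "nilpotent_map e"
    and decomp: "decomposes scale b e
           (map Blk_W ms @ map (\<lambda>(k, m). Blk_Wk k m) kls @ map Blk_V ds)"
    and alpha: "\<alpha> = (GREATEST a. (\<forall>m\<in>set ms. 2 ^ a dvd m) \<and>
                   (\<forall>(k, m)\<in>set kls. 2 ^ a dvd m) \<and> (\<forall>d\<in>set ds. 2 ^ a dvd 2 * d))"
  shows "((\<exists>ms'. decomposes scale b e (map Blk_W ms')) \<longrightarrow>
            dim_gad_fixed scale l v e =
              (if \<alpha> = 0 then dim_gsc_fixed scale b e else dim_gsc_fixed scale b e + 1))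
       \<and> (\<not> (\<exists>ms'. decomposes scale b e (map Blk_W ms')) \<longrightarrow>
            int (dim_gad_fixed scale l v e) =
              (if \<alpha> = 0 then int (dim_gsc_fixed scale b e) - 1 else int (dim_gsc_fixed scale b e)))"
proof -
  interpret char2_standard scale b l v
  proof -
    interpret vector_space scale by (rule vs)
    show "char2_standard scale b l v"
      by unfold_locales (use char_two form l_pos basis in auto)
  qed
  let ?Bs = "map Blk_W ms @ map (\<lambda>(k, m). Blk_Wk k m) kls @ map Blk_V ds"
  have e: "similitude 0 e" using e_sp by (simp add: sp_eq)
  then have le: "lin e" by (simp add: similitude_def)
  have ok: "\<And>B. B \<in> set ?Bs \<Longrightarrow> block_ok B"
    using decomposesE[OF decomp] by blast
  \<comment> \<open>A nonzero multiplier forces every block of the given decomposition to be some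
    \<open>W(m)\<close>. Hence the existence of any decomposition of this form is already decided by
    the given one.\<close>
  have \<delta>1: "(\<exists>c x. c \<noteq> 0 \<and> similitude c x \<and> scalar_commuting e 0 x) \<longleftrightarrow>
      (\<exists>ms'. decomposes scale b e (map Blk_W ms'))"
  proof
    assume "\<exists>c x. c \<noteq> 0 \<and> similitude c x \<and> scalar_commuting e 0 x"
    then obtain c x where x: "similitude c x" "c \<noteq> 0" "scalar_commuting e 0 x" by blast
    note W = similitude_imp_W[OF e decomp x]
    have "kls = []"
      using W[of "Blk_Wk (fst (hd kls)) (snd (hd kls))"]
      by (cases kls) (auto simp: split_beta)
    moreover have "ds = []" using W[of "Blk_V (hd ds)"] by (cases ds) auto
    ultimately show "\<exists>ms'. decomposes scale b e (map Blk_W ms')" using decomp by auto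
  next
    assume "\<exists>ms'. decomposes scale b e (map Blk_W ms')"
    then show "\<exists>c x. c \<noteq> 0 \<and> similitude c x \<and> scalar_commuting e 0 x"
      using W_form_imp_similitude[OF le] zero_neq_one by metis
  qed
  define P where "P a \<longleftrightarrow> (\<forall>m\<in>set ms. 2 ^ a dvd m) \<and>
    (\<forall>(k, m)\<in>set kls. 2 ^ a dvd m) \<and> (\<forall>d\<in>set ds. 2 ^ a dvd 2 * d)" for a :: nat
  have \<alpha>: "\<alpha> = Greatest P" unfolding alpha P_def ..
  \<comment> \<open>For an empty list every exponent would be admissible and \<open>GREATEST\<close>
    would have no maximum to return.\<close>
  have "?Bs \<noteq> []"
  proof
    assume "?Bs = []"
    then have "v 1 = 0" using decomposes_Nil decomp by metis
    then show False using b_1_last by simp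
  qed
  then obtain B where B: "B \<in> set ?Bs" by (meson last_in_set)
  \<comment> \<open>\<open>2 ^ a\<close> divides the positive number
    \<open>2 * block_half B\<close>; the factor 2 treats all three kinds of block alike.\<close>
  have bound: "a \<le> 2 * block_half B" if "P a" for a
  proof -
    have "2 ^ a dvd 2 * block_half B" using B that by (auto simp: P_def)
    then have "2 ^ a \<le> 2 * block_half B"
      using block_half_pos[OF ok[OF B]] by (intro dvd_imp_le) auto
    then show ?thesis using less_exp[of a] by linarith
  qed
  have P\<alpha>: "P \<alpha>" unfolding \<alpha>
    by (rule GreatestI_nat[of P 0]) (use bound in \<open>auto simp: P_def\<close>)
  \<comment> \<open>The sizes \<open>2 * d\<close> are always even, so the blocks
    \<open>V(2d)\<close> impose no condition, in agreement with the exception in the parity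
    lemmas.\<close>
  have P1: "P 1 \<longleftrightarrow> (\<forall>B\<in>set ?Bs. even (block_half B) \<or> (\<exists>d. B = Blk_V d))"
    by (auto simp: P_def ball_Un)
  have \<alpha>1: "\<alpha> \<noteq> 0 \<longleftrightarrow> P 1"
  proof
    assume "\<alpha> \<noteq> 0"
    then have "(2::nat) ^ 1 dvd 2 ^ \<alpha>" by (intro le_imp_power_dvd) simp
    then show "P 1" using P\<alpha> unfolding P_def by (blast intro: dvd_trans)
  next
    assume "P 1"
    then have "1 \<le> \<alpha>" unfolding \<alpha> by (rule Greatest_le_nat) (use bound in auto)
    then show "\<alpha> \<noteq> 0" by simp
  qed
  have \<delta>2: "(\<exists>c d x. d \<noteq> 0 \<and> similitude c x \<and> scalar_commuting e d x) \<longleftrightarrow> \<alpha> \<noteq> 0"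
    unfolding \<alpha>1 P1
  proof
    assume "\<exists>c d x. d \<noteq> 0 \<and> similitude c x \<and> scalar_commuting e d x"
    then obtain d x where "lin x" "d \<noteq> 0" "scalar_commuting e d x" by (auto simp: similitude_def)
    from scalar_commuting_imp_even[OF e decomp this]
    show "\<forall>B\<in>set ?Bs. even (block_half B) \<or> (\<exists>d. B = Blk_V d)" by blast
  next
    assume "\<forall>B\<in>set ?Bs. even (block_half B) \<or> (\<exists>d. B = Blk_V d)"
    then show "\<exists>c d x. d \<noteq> 0 \<and> similitude c x \<and> scalar_commuting e d x"
      using all_even_imp_similitude[OF le decomp] zero_neq_one by metis
  qed
  show ?thesis
    using dim_mod_scalar_fixed[OF le] unfolding \<delta>1 \<delta>2 dim_gad_fixed_eq[OF e, symmetric]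
    by (auto split: if_splits)
qed

end
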